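(* Let $\Omega\subset\mathbb{H}$ be a circular domain and let $f,g\in\mathcal{SEM}(\Omega)\setminus\{0\}$ be such that the operator $\mathcal{L}_{f,g}:\mathcal{SEM}(\Omega)\to\mathcal{SEM}(\Omega)$, $\mathcal{L}_{f,g}(\chi)=f*\chi*g$, is not an isomorphism. If $f$ is a zero divisor, choose $\delta\in\mathbb{H}$ with $|\delta|=1$ and $(f\delta)_0\not\equiv0$, and let $\sigma_f$ be the idempotent determined by $f=2(f\delta)_0\,\sigma_f\,\delta^c$. If $g$ is a zero divisor, choose $\eta\in\mathbb{H}$ with $|\eta|=1$ and $(g\eta)_0\not\equiv0$, and let $\rho_g$ be the idempotent determined by $g=2(g\eta)_0\,\eta^c*\rho_g$. Let $\mathfrak{b}\in\mathcal{SEM}(\Omega)$. Then there exists $\chi\in\mathcal{SEM}(\Omega)$ with $\mathcal{L}_{f,g}(\chi)=\mathfrak{b}$ if and only if both of the following hold: $\mathfrak{b}=\sigma_f*\mathfrak{b}$ in case $f$ is a zero divisor, and $\mathfrak{b}=\mathfrak{b}*\rho_g$ in case $g$ is a zero divisor.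
   Context: $\mathbb{H}$ denotes the quaternions, $q^c$ the quaternionic conjugate, $\mathbb{S}=\{q\in\mathbb{H}: q^2=-1\}$, and $\mathbb{C}_I=\mathbb{R}+I\mathbb{R}$ for $I\in\mathbb{S}$. For $q=x+Iy$ put $\mathbb{S}_q=\{x+Jy: J\in\mathbb{S}\}$. A domain (connected open set) $\Omega\subset\mathbb{H}$ is circular if $\mathbb{S}_q\subset\Omega$ for all $q\in\Omega$. A function $f$ on a circular open set $\Omega$ is slice regular ($f\in\mathcal{SR}(\Omega)$) if $f(x+Iy)=F_1(x,y)+IF_2(x,y)$ for all $x+Iy\in\Omega$ ($x,y\in\mathbb{R}$, $I\in\mathbb{S}$), with $\mathbb{H}$-valued $F_1$ even in $y$ and $F_2$ odd in $y$, and each restriction $f|_{\Omega\cap\mathbb{C}_I}$ is real differentiable with $\frac12(\partial_x+I\partial_y)f|_{\Omega\cap\mathbb{C}_I}\equiv0$. The $*$-product is $(f*g)(q)=0$ if $f(q)=0$ and $(f*g)(q)=f(q)\,g(f(q)^{-1}qf(q))$ otherwise. $f$ is slice preserving if $f(\Omega\cap\mathbb{C}_I)\subset\mathbb{C}_I$ for every $I\in\mathbb{S}$. A function $f$ is slice semi-regular on $\Omega$ ($f\in\mathcal{SEM}(\Omega)$) if there is a circular open $\widetilde\Omega\subseteq\Omega$ with $f\in\mathcal{SR}(\widetilde\Omega)$ and each point of $\Omega\setminus\widetilde\Omega$ is a pole or a removable singularity; i.e. $\Omega\setminus\widetilde\Omega$ consists of isolated real points and isolated spheres $\mathbb{S}_p$,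 near each of which $\Delta_p^m f$ extends slice regularly for some integer $m\ge0$, where $\Delta_p(q)=q^2-2\mathrm{Re}(p)q+|p|^2$. Functions agreeing where both are defined are identified. $\mathcal{SEM}_{\mathbb{R}}(\Omega)$ is the subset of slice preserving elements; it is a field and the center of the algebra $(\mathcal{SEM}(\Omega),+,* )$, which is a 4-dimensional vector space over it: for an orthonormal basis $(1,I,J,K)$ of $\mathbb{H}$, each $f$ is uniquely $f_0+f_1I+f_2J+f_3K$ with $f_\ell\in\mathcal{SEM}_{\mathbb{R}}(\Omega)$. Set $f^c=f_0-(f_1I+f_2J+f_3K)$, $f^s=f*f^c=f_0^2+f_1^2+f_2^2+f_3^2$, $f_0=(f+f^c)/2$. A zero divisor is $f\not\equiv0$ with $f^s\equiv0$ (equivalently $f\not\equiv 0$ and $f*g\equiv0$ for some $g\not\equiv0$). An idempotent is $\sigma\not\equiv0,1$ with $\sigma*\sigma=\sigma$. For a zero divisor $f$, there is always a unitary $\delta\in\mathbb{H}$ with $(f\delta)_0\not\equiv0$, and then $\sigma_f=(2(f\delta)_0)^{-1}f\delta$ and $\rho_f=(2(f\delta)_0)^{-1}\delta*f=\delta*\sigma_f*\delta^c$ are idempotents satisfying $f=2(f\delta)_0\sigma_f\delta^c=2(f\delta)_0\delta^c*\rho_f$. Isomorphism means isomorphism of $\mathcal{SEM}_{\mathbb{R}}(\Omega)$-vector spaces. *)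

theory Defs
  imports "HOL-Analysis.Analysis" "HOL-Algebra.Module"
begin

section \<open>Quaternions\<close>

datatype quat = Quat (qRe: real) (qI: real) (qJ: real) (qK: real)

lemma quat_eq_iff:
  "p = q \<longleftrightarrow> qRe p = qRe q \<and> qI p = qI q \<and> qJ p = qJ q \<and> qK p = qK q"
  by (cases p; cases q) auto

instantiation quat :: "{zero, one, plus, minus, uminus, times}"
begin

definition "0 = Quat 0 0 0 0"
definition "1 = Quat 1 0 0 0"
definition "p + q = Quat (qRe p + qRe q) (qI p + qI q) (qJ p + qJ q) (qK p + qK q)"
definition "p - q = Quat (qRe p - qRe q) (qI p - qI q) (qJ p - qJ q) (qK p - qK q)"
definition "- q = Quat (- qRe q) (- qI q) (- qJ q) (- qK q)"
definition "p * q = Quat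
  (qRe p * qRe q - qI p * qI q - qJ p * qJ q - qK p * qK q)
  (qRe p * qI q + qI p * qRe q + qJ p * qK q - qK p * qJ q)
  (qRe p * qJ q - qI p * qK q + qJ p * qRe q + qK p * qI q)
  (qRe p * qK q + qI p * qJ q - qJ p * qI q + qK p * qRe q)"

instance ..
end

lemma quat_sel [simp]:
  "qRe 0 = 0" "qI 0 = 0" "qJ 0 = 0" "qK 0 = 0"
  "qRe 1 = 1" "qI 1 = 0" "qJ 1 = 0" "qK 1 = 0"
  "qRe (p + q) = qRe p + qRe q" "qI (p + q) = qI p + qI q"
  "qJ (p + q) = qJ p + qJ q" "qK (p + q) = qK p + qK q"
  "qRe (p - q) = qRe p - qRe q" "qI (p - q) = qI p - qI q"
  "qJ (p - q) = qJ p - qJ q" "qK (p - q) = qK p - qK q"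
  "qRe (- q) = - qRe q" "qI (- q) = - qI q" "qJ (- q) = - qJ q" "qK (- q) = - qK q"
  "qRe (p * q) = qRe p * qRe q - qI p * qI q - qJ p * qJ q - qK p * qK q"
  "qI (p * q) = qRe p * qI q + qI p * qRe q + qJ p * qK q - qK p * qJ q"
  "qJ (p * q) = qRe p * qJ q - qI p * qK q + qJ p * qRe q + qK p * qI q"
  "qK (p * q) = qRe p * qK q + qI p * qJ q - qJ p * qI q + qK p * qRe q"
  by (simp_all add: zero_quat_def one_quat_def plus_quat_def minus_quat_def
      uminus_quat_def times_quat_def)

instance quat :: ring_1
  by standard (simp_all add: quat_eq_iff algebra_simps)

instantiation quat :: scaleR
begin
definition "r *\<^sub>R q = Quat (r * qRe q) (r * qI q) (r * qJ q) (r * qK q)"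
instance ..
end

instantiation quat :: real_inner
begin

definition "inner p q = qRe p * qRe q + qI p * qI q + qJ p * qJ q + qK p * qK q"
definition "norm (q :: quat) = sqrt (inner q q)"
definition "dist (p :: quat) q = norm (p - q)"
definition "sgn (q :: quat) = inverse (norm q) *\<^sub>R q"
definition uniformity_quat_def [code del]:
  "(uniformity :: (quat \<times> quat) filter) = (INF e\<in>{0 <..}. principal {(p, q). dist p q < e})"
definition open_quat_def [code del]:
  "open (U :: quat set) \<longleftrightarrow>
    (\<forall>x\<in>U. eventually (\<lambda>(x', y). x' = x \<longrightarrow> y \<in> U) uniformity)"

lemma scaleR_quat_sel [simp]:
  "qRe (r *\<^sub>R q) = r * qRe q" "qI (r *\<^sub>R q) = r * qI q"
  "qJ (r *\<^sub>R q) = r * qJ q" "qK (r *\<^sub>R q) = r * qK q"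
  by (simp_all add: scaleR_quat_def)

instance
proof
  fix p q r :: quat and a b :: real
  show "a *\<^sub>R (p + q) = a *\<^sub>R p + a *\<^sub>R q" "(a + b) *\<^sub>R q = a *\<^sub>R q + b *\<^sub>R q"
    "a *\<^sub>R b *\<^sub>R q = (a * b) *\<^sub>R q" "1 *\<^sub>R q = q"
    by (simp_all add: quat_eq_iff algebra_simps)
  show "inner p q = inner q p" "inner (p + q) r = inner p r + inner q r"
    "inner (a *\<^sub>R p) q = a * inner p q"
    by (simp_all add: inner_quat_def algebra_simps)
  show "0 \<le> inner q q" by (simp add: inner_quat_def)
  show "inner q q = 0 \<longleftrightarrow> q = 0"
  proof
    assume "inner q q = 0"
    then have s: "(qRe q)\<^sup>2 + (qI q)\<^sup>2 + (qJ q)\<^sup>2 + (qK q)\<^sup>2 = 0"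
      by (simp add: inner_quat_def power2_eq_square)
    have "(qRe q)\<^sup>2 = 0 \<and> (qI q)\<^sup>2 = 0 \<and> (qJ q)\<^sup>2 = 0 \<and> (qK q)\<^sup>2 = 0"
      using s zero_le_power2[of "qRe q"] zero_le_power2[of "qI q"]
        zero_le_power2[of "qJ q"] zero_le_power2[of "qK q"] by linarith
    then show "q = 0" by (simp add: quat_eq_iff)
  qed (simp add: inner_quat_def)
qed (simp_all add: norm_quat_def dist_quat_def sgn_quat_def uniformity_quat_def open_quat_def)
end

definition qcnj :: "quat \<Rightarrow> quat"
  where "qcnj q = Quat (qRe q) (- qI q) (- qJ q) (- qK q)"

instantiation quat :: real_normed_div_algebra
begin

definition "inverse q = qcnj q /\<^sub>R inner q q"
definition "p div q = p * inverse (q :: quat)"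

instance
proof
  fix p q :: quat and a :: real
  show "a *\<^sub>R p * q = a *\<^sub>R (p * q)" "p * a *\<^sub>R q = a *\<^sub>R (p * q)"
    by (simp_all add: quat_eq_iff algebra_simps)
  have c: "q * qcnj q = inner q q *\<^sub>R 1" "qcnj q * q = inner q q *\<^sub>R 1"
    by (simp_all add: quat_eq_iff qcnj_def inner_quat_def algebra_simps)
  have l: "x * (b *\<^sub>R y) = b *\<^sub>R (x * y)" "(b *\<^sub>R x) * y = b *\<^sub>R (x * y)"
    for x y :: quat and b
    by (simp_all add: quat_eq_iff algebra_simps)
  show "q \<noteq> 0 \<Longrightarrow> inverse q * q = 1" "q \<noteq> 0 \<Longrightarrow> q * inverse q = 1"
    by (simp_all add: inverse_quat_def l c)
  show "p div q = p * inverse q" by (simp add: divide_quat_def)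
  show "inverse (0 :: quat) = 0"
    by (simp add: inverse_quat_def)
  have "inner (p * q) (p * q) = inner p p * inner q q"
    by (simp add: inner_quat_def algebra_simps)
  then show "norm (p * q) = norm p * norm q"
    by (simp add: norm_quat_def real_sqrt_mult)
qed
end

section \<open>Circular sets and slice regular functions\<close>

definition imag_units :: "quat set"
  where "imag_units = {q. q\<^sup>2 = - 1}"

definition slice_pt :: "quat \<Rightarrow> real \<Rightarrow> real \<Rightarrow> quat"
  where "slice_pt I x y = of_real x + I * of_real y"

definition slice_plane :: "quat \<Rightarrow> quat set"
  where "slice_plane I = {slice_pt I x y | x y. True}"

definition qsphere :: "quat \<Rightarrow> quat set"
  where "qsphere q =
    {slice_pt J x y | J x y. J \<in> imag_units \<and> (\<exists>I\<in>imag_units. q = slice_pt I x y)}"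

definition circular :: "quat set \<Rightarrow> bool"
  where "circular U \<longleftrightarrow> (\<forall>q\<in>U. qsphere q \<subseteq> U)"

definition circular_domain :: "quat set \<Rightarrow> bool"
  where "circular_domain U \<longleftrightarrow> open U \<and> connected U \<and> circular U"

definition slice_regular_on :: "(quat \<Rightarrow> quat) \<Rightarrow> quat set \<Rightarrow> bool"
  where "slice_regular_on f U \<longleftrightarrow>
    (\<exists>F1 F2 :: real \<Rightarrow> real \<Rightarrow> quat. \<forall>x y. \<forall>I\<in>imag_units. slice_pt I x y \<in> U \<longrightarrow>
      F1 x (- y) = F1 x y \<and> F2 x (- y) = - F2 x y \<and>
      f (slice_pt I x y) = F1 x y + I * F2 x y) \<and>
    (\<forall>I\<in>imag_units. \<forall>x y. slice_pt I x y \<in> U \<longrightarrow>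
      (\<exists>D. ((\<lambda>(u, v). f (slice_pt I u v)) has_derivative D) (at (x, y)) \<and>
        (1 / 2) *\<^sub>R (D (1, 0) + I * D (0, 1)) = 0))"

definition star :: "(quat \<Rightarrow> quat) \<Rightarrow> (quat \<Rightarrow> quat) \<Rightarrow> quat \<Rightarrow> quat"
  where "star f g q = (if f q = 0 then 0 else f q * g (inverse (f q) * q * f q))"

section \<open>Slice semi-regular functions\<close>

text \<open>A semi-regular function is first represented by a partial function whose domain is the set
  where it is regular; the elements of the algebra are classes of such partial functions, two of
  them being identified when they agree on the intersection of their domains.\<close>

type_synonym qpfun = "quat \<rightharpoonup> quat"

definition qdelta :: "quat \<Rightarrow> quat \<Rightarrow> quat"
  where "qdelta p q = q\<^sup>2 - of_real (2 * qRe p) * q + of_real ((norm p)\<^sup>2)"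

text \<open>For real \<open>p\<close> the sphere of \<open>p\<close> is \<open>{p}\<close>, so that isolated real points and isolated
  spheres are covered by the same condition. Powers of \<open>qdelta p\<close> are slice preserving, so their
  \<open>star\<close>-product with another function is the pointwise product.\<close>

definition pole_or_removable :: "quat set \<Rightarrow> qpfun \<Rightarrow> quat \<Rightarrow> bool"
  where "pole_or_removable \<Omega> f p \<longleftrightarrow>
    (\<exists>V m h. open V \<and> circular V \<and> qsphere p \<subseteq> V \<and> V \<subseteq> \<Omega> \<and> V - qsphere p \<subseteq> dom f \<and>
      slice_regular_on h V \<and>
      (\<forall>q\<in>V - qsphere p. h q = qdelta p q ^ m * the (f q)))"

definition semireg_funs :: "quat set \<Rightarrow> qpfun set"
  where "semireg_funs \<Omega> =
    {f. dom f \<subseteq> \<Omega> \<and> open (dom f) \<and> circular (dom f) \<and>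
        slice_regular_on (\<lambda>q. the (f q)) (dom f) \<and>
        (\<forall>p\<in>\<Omega> - dom f. pole_or_removable \<Omega> f p)}"

definition semireg_eq :: "quat set \<Rightarrow> (qpfun \<times> qpfun) set"
  where "semireg_eq \<Omega> =
    {(f, g). f \<in> semireg_funs \<Omega> \<and> g \<in> semireg_funs \<Omega> \<and> (\<forall>q\<in>dom f \<inter> dom g. f q = g q)}"

definition pf_add :: "qpfun \<Rightarrow> qpfun \<Rightarrow> qpfun"
  where "pf_add f g = (\<lambda>q. if q \<in> dom f \<inter> dom g then Some (the (f q) + the (g q)) else None)"

definition pf_star :: "qpfun \<Rightarrow> qpfun \<Rightarrow> qpfun"
  where "pf_star f g =
    (\<lambda>q. if q \<in> dom f \<inter> dom g then Some (star (\<lambda>p. the (f p)) (\<lambda>p. the (g p)) q) else None)"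

type_synonym sem = "qpfun set"

definition sem_const :: "quat set \<Rightarrow> quat \<Rightarrow> sem"
  where "sem_const \<Omega> a = semireg_eq \<Omega> `` {\<lambda>q. if q \<in> \<Omega> then Some a else None}"

definition sem_add :: "quat set \<Rightarrow> sem \<Rightarrow> sem \<Rightarrow> sem"
  where "sem_add \<Omega> F G = (\<Union>f\<in>F. \<Union>g\<in>G. semireg_eq \<Omega> `` {pf_add f g})"

definition sem_mult :: "quat set \<Rightarrow> sem \<Rightarrow> sem \<Rightarrow> sem"
  where "sem_mult \<Omega> F G = (\<Union>f\<in>F. \<Union>g\<in>G. semireg_eq \<Omega> `` {pf_star f g})"

text \<open>The algebra of semi-regular functions, with scalar multiplication by slice preserving
  elements given by the \<open>star\<close>-product.\<close>

definition SEM :: "quat set \<Rightarrow> (sem, sem) module"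
  where "SEM \<Omega> =
    \<lparr>carrier = semireg_funs \<Omega> // semireg_eq \<Omega>, mult = sem_mult \<Omega>, one = sem_const \<Omega> 1,
     zero = sem_const \<Omega> 0, add = sem_add \<Omega>, smult = sem_mult \<Omega>\<rparr>"

definition slice_preserving :: "qpfun \<Rightarrow> bool"
  where "slice_preserving f \<longleftrightarrow>
    (\<forall>I\<in>imag_units. (\<lambda>q. the (f q)) ` (dom f \<inter> slice_plane I) \<subseteq> slice_plane I)"

definition SEM_R :: "quat set \<Rightarrow> (sem, sem) module"
  where "SEM_R \<Omega> =
    (SEM \<Omega>)\<lparr>carrier := {F \<in> carrier (SEM \<Omega>). \<exists>f\<in>F. slice_preserving f}\<rparr>"

definition sem_vec :: "quat set \<Rightarrow> sem \<Rightarrow> sem \<Rightarrow> sem \<Rightarrow> sem"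
  where "sem_vec \<Omega> f1 f2 f3 =
    f1 \<otimes>\<^bsub>SEM \<Omega>\<^esub> sem_const \<Omega> (Quat 0 1 0 0) \<oplus>\<^bsub>SEM \<Omega>\<^esub>
    f2 \<otimes>\<^bsub>SEM \<Omega>\<^esub> sem_const \<Omega> (Quat 0 0 1 0) \<oplus>\<^bsub>SEM \<Omega>\<^esub>
    f3 \<otimes>\<^bsub>SEM \<Omega>\<^esub> sem_const \<Omega> (Quat 0 0 0 1)"

text \<open>The decomposition of \<open>f\<close> with respect to the standard basis \<open>1, i, j, k\<close>; it exists and is
  unique on a circular domain.\<close>

definition sem_components ::
  "quat set \<Rightarrow> sem \<Rightarrow> sem \<Rightarrow> sem \<Rightarrow> sem \<Rightarrow> sem \<Rightarrow> bool"
  where "sem_components \<Omega> f f0 f1 f2 f3 \<longleftrightarrow>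
    {f0, f1, f2, f3} \<subseteq> carrier (SEM_R \<Omega>) \<and>
    f = f0 \<oplus>\<^bsub>SEM \<Omega>\<^esub> sem_vec \<Omega> f1 f2 f3"

definition sem_re :: "quat set \<Rightarrow> sem \<Rightarrow> sem"
  where "sem_re \<Omega> f = (THE f0. \<exists>f1 f2 f3. sem_components \<Omega> f f0 f1 f2 f3)"

definition sem_conj :: "quat set \<Rightarrow> sem \<Rightarrow> sem"
  where "sem_conj \<Omega> f = (THE h. \<exists>f0 f1 f2 f3. sem_components \<Omega> f f0 f1 f2 f3 \<and>
    h = f0 \<ominus>\<^bsub>SEM \<Omega>\<^esub> sem_vec \<Omega> f1 f2 f3)"

definition sem_symm :: "quat set \<Rightarrow> sem \<Rightarrow> sem"
  where "sem_symm \<Omega> f = f \<otimes>\<^bsub>SEM \<Omega>\<^esub> sem_conj \<Omega> f"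

definition sem_zero_divisor :: "quat set \<Rightarrow> sem \<Rightarrow> bool"
  where "sem_zero_divisor \<Omega> f \<longleftrightarrow>
    f \<in> carrier (SEM \<Omega>) \<and> f \<noteq> \<zero>\<^bsub>SEM \<Omega>\<^esub> \<and> sem_symm \<Omega> f = \<zero>\<^bsub>SEM \<Omega>\<^esub>"

text \<open>For a zero divisor \<open>f\<close> and a unit quaternion \<open>d\<close> with nonzero \<open>(f d)\<^sub>0\<close>, these are the
  idempotents with \<open>f = 2(f d)\<^sub>0 \<sigma> d\<^sup>c\<close> and \<open>f = 2(f d)\<^sub>0 d\<^sup>c * \<rho>\<close>. The inverse is that of the
  field \<open>SEM_R \<Omega>\<close>.\<close>

definition sem_sigma :: "quat set \<Rightarrow> sem \<Rightarrow> quat \<Rightarrow> sem"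
  where "sem_sigma \<Omega> f d =
    inv\<^bsub>SEM_R \<Omega>\<^esub> (sem_const \<Omega> 2 \<otimes>\<^bsub>SEM \<Omega>\<^esub> sem_re \<Omega> (f \<otimes>\<^bsub>SEM \<Omega>\<^esub> sem_const \<Omega> d))
      \<otimes>\<^bsub>SEM \<Omega>\<^esub> (f \<otimes>\<^bsub>SEM \<Omega>\<^esub> sem_const \<Omega> d)"

definition sem_rho :: "quat set \<Rightarrow> sem \<Rightarrow> quat \<Rightarrow> sem"
  where "sem_rho \<Omega> f d =
    inv\<^bsub>SEM_R \<Omega>\<^esub> (sem_const \<Omega> 2 \<otimes>\<^bsub>SEM \<Omega>\<^esub> sem_re \<Omega> (f \<otimes>\<^bsub>SEM \<Omega>\<^esub> sem_const \<Omega> d))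
      \<otimes>\<^bsub>SEM \<Omega>\<^esub> (sem_const \<Omega> d \<otimes>\<^bsub>SEM \<Omega>\<^esub> f)"

definition sem_L :: "quat set \<Rightarrow> sem \<Rightarrow> sem \<Rightarrow> sem \<Rightarrow> sem"
  where "sem_L \<Omega> f g x = f \<otimes>\<^bsub>SEM \<Omega>\<^esub> x \<otimes>\<^bsub>SEM \<Omega>\<^esub> g"

definition module_iso ::
  "('r, 'x) ring_scheme \<Rightarrow> ('r, 'a, 'y) module_scheme \<Rightarrow> ('r, 'b, 'z) module_scheme \<Rightarrow> ('a \<Rightarrow> 'b) set"
  where "module_iso R M N =
    {h \<in> iso (add_monoid M) (add_monoid N).
      \<forall>r\<in>carrier R. \<forall>x\<in>carrier M. h (r \<odot>\<^bsub>M\<^esub> x) = r \<odot>\<^bsub>N\<^esub> h x}"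

end

theory Submission
  imports Defs "HOL-Complex_Analysis.Complex_Analysis"
begin

text \<open>A slice regular function is determined by its stem function \<open>F1 + \<iota> F2\<close>, which takes values in
  the complexified quaternions \<open>\<bbbH> \<otimes> \<complex>\<close>. Being regular means that the four complex coordinates of the
  stem function are holomorphic, and the \<open>star\<close>-product of functions is the pointwise product of
  their stem functions. On a slice, \<open>qdelta p\<close> is the polynomial \<open>(z - w) * (z - cnj w)\<close>, where \<open>w\<close> is
  the complex coordinate of \<open>p\<close>; hence a function is semi-regular exactly if its stem function is
  meromorphic. Altogether the algebra of semi-regular functions on \<open>\<Omega>\<close> becomes the algebra of
  meromorphic functions \<open>\<phi>\<close> on \<open>{x + iy. x + Iy \<in> \<Omega>}\<close> with values in \<open>\<bbbH> \<otimes> \<complex>\<close> and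
  \<open>\<phi> (cnj z) = cnj (\<phi> z)\<close>, where functions that agree off a sparse set are identified. This is the
  content of \<open>carrier_SEM\<close>, \<open>cls_eq_iff\<close>, \<open>add_SEM\<close> and \<open>mult_SEM\<close>. The slice preserving elements are
  the scalar-valued \<open>\<phi>\<close>; by the identity theorem (\<open>real_meromorphic_zero_or_nonzero\<close>) a nonzero one
  of them vanishes only on a sparse set, so that it has an inverse.

  In this model an identity between semi-regular functions is an identity in the ring
  \<open>\<bbbH> \<otimes> \<complex>\<close>, to be checked at almost every point. If \<open>f\<close> is not a zero divisor, then
  \<open>f\<^sup>s\<close> is a nonzero scalar and \<open>f\<close> is invertible. If \<open>f\<close> is a zero divisor, then \<open>h = f \<delta>\<close> has
  \<open>h\<^sup>s = 0\<close>, hence \<open>h * h = 2 h\<^sub>0 h\<close>, and this gives \<open>\<sigma> * f = f\<close> for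
  \<open>\<sigma> = (2 h\<^sub>0)\<^sup>-\<^sup>1 h\<close> (\<open>biquat_null_normalize\<close>); moreover \<open>\<sigma> = f * p\<close> with \<open>p = (2 h\<^sub>0)\<^sup>-\<^sup>1 \<delta>\<close>. So there are
  always \<open>p\<close> and \<open>s\<close> with \<open>f * p = s\<close> and \<open>s * f = f\<close>, where \<open>s\<close> is \<open>\<sigma>\<close> or \<open>1\<close>, and in the same way \<open>q\<close>
  and \<open>r\<close> with \<open>q * g = r\<close> and \<open>g * r = g\<close>, where \<open>r\<close> is \<open>\<rho>\<close> or \<open>1\<close>. In any monoid these relations
  give the criterion: from \<open>b = f * x * g\<close> follows \<open>s * b = b = b * r\<close>, and if
  \<open>s * b = b = b * r\<close>, then \<open>x = p * b * q\<close> is a solution.\<close>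

section \<open>Slice coordinates on the quaternions\<close>

text \<open>For an imaginary unit \<open>I\<close> this is the ring embedding of the complex numbers that sends \<open>\<i>\<close> to \<open>I\<close>;
  with it computations on a slice become computations with complex numbers.\<close>

definition slice_emb :: "quat \<Rightarrow> complex \<Rightarrow> quat"
  where "slice_emb I z = slice_pt I (Re z) (Im z)"

lemma slice_pt_eq_slice_emb: "slice_pt I x y = slice_emb I (Complex x y)"
  by (simp add: slice_emb_def)

lemma of_real_quat_sel [simp]:
  "qRe (of_real r) = r" "qI (of_real r) = 0" "qJ (of_real r) = 0" "qK (of_real r) = 0"
  by (simp_all add: of_real_def)

lemma slice_emb_sel [simp]:
  "qRe (slice_emb I z) = Re z + qRe I * Im z" "qI (slice_emb I z) = qI I * Im z"
  "qJ (slice_emb I z) = qJ I * Im z" "qK (slice_emb I z) = qK I * Im z"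
  by (simp_all add: slice_emb_def slice_pt_def)

text \<open>The vector part of \<open>q\<^sup>2\<close> is \<open>2 (Re q)\<close> times the vector part of \<open>q\<close>; so a square root of \<open>- 1\<close>
  with nonzero real part would be a real number.\<close>

lemma imag_units_iff:
  "I \<in> imag_units \<longleftrightarrow> qRe I = 0 \<and> (qI I)\<^sup>2 + (qJ I)\<^sup>2 + (qK I)\<^sup>2 = 1"
proof
  assume "I \<in> imag_units"
  then have sq: "I * I = - 1"
    by (simp add: imag_units_def power2_eq_square)
  have re: "qRe I * qRe I - qI I * qI I - qJ I * qJ I - qK I * qK I = - 1"
    and v: "qRe I * qI I = 0" "qRe I * qJ I = 0" "qRe I * qK I = 0"
    using sq by (auto simp: quat_eq_iff)
  have "qRe I = 0"
  proof (rule ccontr)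
    assume "qRe I \<noteq> 0"
    with re v have "qRe I * qRe I = - 1" by simp
    then show False
      by (smt (verit) zero_le_square)
  qed
  with re show "qRe I = 0 \<and> (qI I)\<^sup>2 + (qJ I)\<^sup>2 + (qK I)\<^sup>2 = 1"
    by (simp add: power2_eq_square)
next
  assume "qRe I = 0 \<and> (qI I)\<^sup>2 + (qJ I)\<^sup>2 + (qK I)\<^sup>2 = 1"
  then show "I \<in> imag_units"
    by (simp add: imag_units_def quat_eq_iff power2_eq_square)
qed

lemma imag_units_mult_self: "I \<in> imag_units \<Longrightarrow> I * I = - 1"
  by (simp add: imag_units_def power2_eq_square)

lemma imag_units_uminus: "I \<in> imag_units \<Longrightarrow> - I \<in> imag_units"
  by (simp add: imag_units_def)

abbreviation quat_i :: quat where "quat_i \<equiv> Quat 0 1 0 0"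
abbreviation quat_j :: quat where "quat_j \<equiv> Quat 0 0 1 0"
abbreviation quat_k :: quat where "quat_k \<equiv> Quat 0 0 0 1"

lemma quat_i_imag_unit [simp]: "quat_i \<in> imag_units" "quat_j \<in> imag_units" "quat_k \<in> imag_units"
  by (simp_all add: imag_units_iff)

lemma slice_emb_of_real [simp]: "slice_emb I (of_real r) = of_real r"
  by (simp add: quat_eq_iff)

lemma slice_emb_0 [simp]: "slice_emb I 0 = 0" and slice_emb_1 [simp]: "slice_emb I 1 = 1"
  by (simp_all add: quat_eq_iff)

lemma slice_emb_add: "slice_emb I (z + w) = slice_emb I z + slice_emb I w"
  and slice_emb_diff: "slice_emb I (z - w) = slice_emb I z - slice_emb I w"
  by (simp_all add: quat_eq_iff algebra_simps)

lemma slice_emb_uminus_unit: "slice_emb (- I) z = slice_emb I (cnj z)"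
  by (simp add: quat_eq_iff)

lemma slice_emb_mult:
  assumes "I \<in> imag_units"
  shows "slice_emb I (z * w) = slice_emb I z * slice_emb I w"
proof -
  have re: "qRe I = 0" and n: "qI I * qI I + qJ I * qJ I + qK I * qK I = 1"
    using assms by (simp_all add: imag_units_iff power2_eq_square)
  have "Im z * Im w * (qI I * qI I + qJ I * qJ I + qK I * qK I) = Im z * Im w"
    by (simp add: n)
  with re show ?thesis
    by (simp add: quat_eq_iff algebra_simps)
qed

lemma slice_emb_power: "I \<in> imag_units \<Longrightarrow> slice_emb I (z ^ n) = slice_emb I z ^ n"
  by (induction n) (simp_all add: slice_emb_mult)

lemma bounded_linear_slice_emb: "bounded_linear (slice_emb I)"
proof -
  have "slice_emb I = (\<lambda>z. of_real (Re z) + I * of_real (Im z))"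
    by (simp add: fun_eq_iff slice_emb_def slice_pt_def)
  then show ?thesis
    by (simp add: bounded_linear_add bounded_linear_Re bounded_linear_Im
      bounded_linear_compose[OF bounded_linear_of_real]
      bounded_linear_compose[OF bounded_linear_mult_right])
qed

lemma continuous_on_slice_emb [continuous_intros]:
  "continuous_on A f \<Longrightarrow> continuous_on A (\<lambda>x. slice_emb I (f x))"
  by (rule bounded_linear.continuous_on[OF bounded_linear_slice_emb])

lemma bounded_linear_quat_coords:
  "bounded_linear qRe" "bounded_linear qI" "bounded_linear qJ" "bounded_linear qK"
proof -
  have eq: "qRe = (\<lambda>q. inner q 1)" "qI = (\<lambda>q. inner q quat_i)" "qJ = (\<lambda>q. inner q quat_j)"
    "qK = (\<lambda>q. inner q quat_k)"
    by (simp_all add: fun_eq_iff inner_quat_def)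
  show "bounded_linear qRe" "bounded_linear qI" "bounded_linear qJ" "bounded_linear qK"
    unfolding eq by (rule bounded_linear_inner_left)+
qed

text \<open>The point of the closed upper half plane that represents the sphere of \<open>q\<close>.\<close>

definition slice_coord :: "quat \<Rightarrow> complex"
  where "slice_coord q = Complex (qRe q) (sqrt ((qI q)\<^sup>2 + (qJ q)\<^sup>2 + (qK q)\<^sup>2))"

text \<open>At real points, which have no direction, \<open>quat_i\<close> is an arbitrary choice.\<close>

definition slice_unit :: "quat \<Rightarrow> quat"
  where "slice_unit q =
    (let r = Im (slice_coord q) in if r = 0 then quat_i else Quat 0 (qI q / r) (qJ q / r) (qK q / r))"

lemma Im_slice_coord_ge_0: "Im (slice_coord q) \<ge> 0"
  by (simp add: slice_coord_def)

lemma Im_slice_coord_square: "(Im (slice_coord q))\<^sup>2 = (qI q)\<^sup>2 + (qJ q)\<^sup>2 + (qK q)\<^sup>2"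
  by (simp add: slice_coord_def)

lemma slice_unit_imag_unit [simp]: "slice_unit q \<in> imag_units"
proof (cases "Im (slice_coord q) = 0")
  case False
  then show ?thesis
    by (simp add: slice_unit_def Let_def imag_units_iff power_divide
        flip: add_divide_distrib Im_slice_coord_square)
qed (simp add: slice_unit_def)

lemma slice_emb_slice_coord [simp]: "slice_emb (slice_unit q) (slice_coord q) = q"
proof (cases "Im (slice_coord q) = 0")
  case True
  then have "(qI q)\<^sup>2 + (qJ q)\<^sup>2 + (qK q)\<^sup>2 = 0"
    using Im_slice_coord_square[of q] by simp
  then have "qI q = 0" "qJ q = 0" "qK q = 0"
    by (simp_all add: add_nonneg_eq_0_iff)
  with True show ?thesis
    by (simp add: slice_unit_def Let_def quat_eq_iff) (simp add: slice_coord_def)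
next
  case False
  then show ?thesis
    by (simp add: slice_unit_def Let_def quat_eq_iff) (simp add: slice_coord_def)
qed

lemma slice_coord_slice_emb:
  assumes "I \<in> imag_units"
  shows "slice_coord (slice_emb I z) = Complex (Re z) \<bar>Im z\<bar>"
proof -
  have "(qI I * Im z)\<^sup>2 + (qJ I * Im z)\<^sup>2 + (qK I * Im z)\<^sup>2
      = ((qI I)\<^sup>2 + (qJ I)\<^sup>2 + (qK I)\<^sup>2) * (Im z)\<^sup>2"
    by (simp add: power_mult_distrib algebra_simps)
  also have "\<dots> = (Im z)\<^sup>2"
    using assms by (simp add: imag_units_iff)
  finally show ?thesis
    using assms by (simp add: slice_coord_def imag_units_iff)
qed

lemma continuous_on_slice_coord: "continuous_on A slice_coord"
  unfolding slice_coord_def Complex_eq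
  by (intro continuous_intros bounded_linear.continuous_on[OF bounded_linear_quat_coords(1)]
      bounded_linear.continuous_on[OF bounded_linear_quat_coords(2)]
      bounded_linear.continuous_on[OF bounded_linear_quat_coords(3)]
      bounded_linear.continuous_on[OF bounded_linear_quat_coords(4)])

lemma slice_coord_eqD:
  assumes "I \<in> imag_units" "slice_coord (slice_emb I z) = w"
  shows "z = w \<or> z = cnj w"
  using assms by (auto simp: slice_coord_slice_emb complex_eq_iff abs_if split: if_splits)

text \<open>A sphere is a fibre of \<open>slice_coord\<close>, so that a circular set is the preimage of a set of complex
  numbers.\<close>

lemma qsphere_eq: "qsphere q = {p. slice_coord p = slice_coord q}"
proof (intro Set.set_eqI iffI)
  fix p assume "p \<in> qsphere q"
  then show "p \<in> {p. slice_coord p = slice_coord q}"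
    by (auto simp: qsphere_def slice_pt_eq_slice_emb slice_coord_slice_emb)
next
  fix p assume "p \<in> {p. slice_coord p = slice_coord q}"
  then have "p = slice_emb (slice_unit p) (slice_coord q)"
    using slice_emb_slice_coord[of p] by simp
  then show "p \<in> qsphere q"
    unfolding qsphere_def slice_emb_def
    by (metis (mono_tags, lifting) mem_Collect_eq slice_emb_def slice_emb_slice_coord
        slice_unit_imag_unit)
qed

lemma circular_iff:
  "circular U \<longleftrightarrow> (\<forall>p q. slice_coord p = slice_coord q \<longrightarrow> q \<in> U \<longrightarrow> p \<in> U)"
  by (auto simp: circular_def qsphere_eq)

text \<open>For a circular set the choice of the unit is immaterial, see \<open>slice_emb_mem_iff\<close>.\<close>

definition stem_dom :: "quat set \<Rightarrow> complex set"
  where "stem_dom U = {z. slice_emb quat_i z \<in> U}"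

lemma slice_emb_mem_iff:
  assumes "circular U" "I \<in> imag_units"
  shows "slice_emb I z \<in> U \<longleftrightarrow> z \<in> stem_dom U"
proof -
  have "slice_coord (slice_emb I z) = slice_coord (slice_emb quat_i z)"
    using assms(2) by (simp add: slice_coord_slice_emb)
  with assms(1) show ?thesis
    unfolding circular_iff stem_dom_def by (metis mem_Collect_eq)
qed

lemma slice_coord_mem_iff: "circular U \<Longrightarrow> slice_coord q \<in> stem_dom U \<longleftrightarrow> q \<in> U"
  using slice_emb_mem_iff[of U "slice_unit q" "slice_coord q"] by simp

lemma cnj_mem_stem_dom_iff:
  assumes "circular U"
  shows "cnj z \<in> stem_dom U \<longleftrightarrow> z \<in> stem_dom U"
  using slice_emb_mem_iff[OF assms, of quat_i z] slice_emb_mem_iff[OF assms, of "- quat_i" "cnj z"]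
  by (simp add: imag_units_uminus slice_emb_uminus_unit)

lemma open_stem_dom: "open U \<Longrightarrow> open (stem_dom U)"
proof -
  assume "open U"
  moreover have "stem_dom U = slice_emb quat_i -` U"
    by (auto simp: stem_dom_def)
  moreover have "continuous_on UNIV (slice_emb quat_i)"
    by (intro continuous_intros)
  ultimately show ?thesis
    by (simp add: open_vimage)
qed

lemma stem_dom_Int: "stem_dom (U \<inter> V) = stem_dom U \<inter> stem_dom V"
  by (auto simp: stem_dom_def)

lemma stem_dom_mono: "U \<subseteq> V \<Longrightarrow> stem_dom U \<subseteq> stem_dom V"
  by (auto simp: stem_dom_def)

lemma circular_Int: "circular U \<Longrightarrow> circular V \<Longrightarrow> circular (U \<inter> V)"
  by (auto simp: circular_def)

text \<open>Circular open sets are made from symmetric open subsets of the plane by rotating them about the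
  real axis. Symmetry is needed because \<open>slice_coord\<close> only sees the upper half plane.\<close>

lemma vimage_slice_coord:
  assumes "open W" "\<And>z. z \<in> W \<Longrightarrow> cnj z \<in> W"
  shows "open (slice_coord -` W)" "circular (slice_coord -` W)" "stem_dom (slice_coord -` W) = W"
proof -
  show "open (slice_coord -` W)"
    using assms(1) continuous_on_slice_coord by (rule open_vimage)
  show "circular (slice_coord -` W)"
    by (simp add: circular_iff)
  have "z \<in> stem_dom (slice_coord -` W) \<longleftrightarrow> z \<in> W" for z
  proof -
    have "Complex (Re z) \<bar>Im z\<bar> = z \<or> Complex (Re z) \<bar>Im z\<bar> = cnj z"
      by (auto simp: complex_eq_iff)
    then show ?thesis
      using assms(2)[of z] assms(2)[of "cnj z"]
      by (auto simp: stem_dom_def slice_coord_slice_emb)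
  qed
  then show "stem_dom (slice_coord -` W) = W"
    by blast
qed

section \<open>Complexified quaternions\<close>

text \<open>The algebra \<open>\<bbbH> \<otimes> \<complex>\<close>, with the coordinates of \<open>quat\<close> made complex. Four complex coordinates are used,
  and not a pair of quaternions, because holomorphic and meromorphic functions are complex-valued.\<close>

datatype biquat = Biquat (b0: complex) (b1: complex) (b2: complex) (b3: complex)

lemma biquat_eq_iff: "v = w \<longleftrightarrow> b0 v = b0 w \<and> b1 v = b1 w \<and> b2 v = b2 w \<and> b3 v = b3 w"
  by (cases v; cases w) auto

instantiation biquat :: "{zero, one, plus, minus, uminus, times}"
begin

definition "0 = Biquat 0 0 0 0"
definition "1 = Biquat 1 0 0 0"
definition "v + w = Biquat (b0 v + b0 w) (b1 v + b1 w) (b2 v + b2 w) (b3 v + b3 w)"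
definition "v - w = Biquat (b0 v - b0 w) (b1 v - b1 w) (b2 v - b2 w) (b3 v - b3 w)"
definition "- w = Biquat (- b0 w) (- b1 w) (- b2 w) (- b3 w)"
definition "v * w = Biquat
  (b0 v * b0 w - b1 v * b1 w - b2 v * b2 w - b3 v * b3 w)
  (b0 v * b1 w + b1 v * b0 w + b2 v * b3 w - b3 v * b2 w)
  (b0 v * b2 w - b1 v * b3 w + b2 v * b0 w + b3 v * b1 w)
  (b0 v * b3 w + b1 v * b2 w - b2 v * b1 w + b3 v * b0 w)"

instance ..
end

lemma biquat_sel [simp]:
  "b0 0 = 0" "b1 0 = 0" "b2 0 = 0" "b3 0 = 0"
  "b0 1 = 1" "b1 1 = 0" "b2 1 = 0" "b3 1 = 0"
  "b0 (v + w) = b0 v + b0 w" "b1 (v + w) = b1 v + b1 w"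
  "b2 (v + w) = b2 v + b2 w" "b3 (v + w) = b3 v + b3 w"
  "b0 (v - w) = b0 v - b0 w" "b1 (v - w) = b1 v - b1 w"
  "b2 (v - w) = b2 v - b2 w" "b3 (v - w) = b3 v - b3 w"
  "b0 (- w) = - b0 w" "b1 (- w) = - b1 w" "b2 (- w) = - b2 w" "b3 (- w) = - b3 w"
  "b0 (v * w) = b0 v * b0 w - b1 v * b1 w - b2 v * b2 w - b3 v * b3 w"
  "b1 (v * w) = b0 v * b1 w + b1 v * b0 w + b2 v * b3 w - b3 v * b2 w"
  "b2 (v * w) = b0 v * b2 w - b1 v * b3 w + b2 v * b0 w + b3 v * b1 w"
  "b3 (v * w) = b0 v * b3 w + b1 v * b2 w - b2 v * b1 w + b3 v * b0 w"
  by (simp_all add: zero_biquat_def one_biquat_def plus_biquat_def minus_biquat_def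
      uminus_biquat_def times_biquat_def)

instance biquat :: ring_1
  by standard (simp_all add: biquat_eq_iff algebra_simps)

definition bscalar :: "complex \<Rightarrow> biquat"
  where "bscalar c = Biquat c 0 0 0"

definition bconst :: "quat \<Rightarrow> biquat"
  where "bconst a = Biquat (of_real (qRe a)) (of_real (qI a)) (of_real (qJ a)) (of_real (qK a))"

text \<open>Complex conjugation of the coefficients, as opposed to quaternionic conjugation \<open>bconj\<close>.\<close>

definition bcnj :: "biquat \<Rightarrow> biquat"
  where "bcnj w = Biquat (cnj (b0 w)) (cnj (b1 w)) (cnj (b2 w)) (cnj (b3 w))"

definition bconj :: "biquat \<Rightarrow> biquat"
  where "bconj w = Biquat (b0 w) (- b1 w) (- b2 w) (- b3 w)"

definition bnorm :: "biquat \<Rightarrow> complex"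
  where "bnorm w = (b0 w)\<^sup>2 + (b1 w)\<^sup>2 + (b2 w)\<^sup>2 + (b3 w)\<^sup>2"

lemma bscalar_sel [simp]: "b0 (bscalar c) = c" "b1 (bscalar c) = 0" "b2 (bscalar c) = 0"
  "b3 (bscalar c) = 0"
  by (simp_all add: bscalar_def)

lemma bconst_sel [simp]: "b0 (bconst a) = of_real (qRe a)" "b1 (bconst a) = of_real (qI a)"
  "b2 (bconst a) = of_real (qJ a)" "b3 (bconst a) = of_real (qK a)"
  by (simp_all add: bconst_def)

lemma bcnj_sel [simp]: "b0 (bcnj w) = cnj (b0 w)" "b1 (bcnj w) = cnj (b1 w)"
  "b2 (bcnj w) = cnj (b2 w)" "b3 (bcnj w) = cnj (b3 w)"
  by (simp_all add: bcnj_def)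

lemma bconj_sel [simp]: "b0 (bconj w) = b0 w" "b1 (bconj w) = - b1 w"
  "b2 (bconj w) = - b2 w" "b3 (bconj w) = - b3 w"
  by (simp_all add: bconj_def)

lemma mult_bconj: "w * bconj w = bscalar (bnorm w)"
  by (simp add: biquat_eq_iff bnorm_def power2_eq_square algebra_simps)

text \<open>The map from \<open>\<bbbH> \<otimes> \<complex>\<close> to \<open>\<bbbH>\<close>, linear over quaternions on the right, that replaces the complex
  unit of the coefficients by \<open>I\<close>. Applied to the value of the stem function at \<open>x + iy\<close>, it yields the value of the
  slice function at \<open>x + Iy\<close>.\<close>

definition bq_eval :: "quat \<Rightarrow> biquat \<Rightarrow> quat"
  where "bq_eval I w = slice_emb I (b0 w) + slice_emb I (b1 w) * quat_i
    + slice_emb I (b2 w) * quat_j + slice_emb I (b3 w) * quat_k"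

definition bq_re :: "biquat \<Rightarrow> quat"
  where "bq_re w = Quat (Re (b0 w)) (Re (b1 w)) (Re (b2 w)) (Re (b3 w))"

definition bq_im :: "biquat \<Rightarrow> quat"
  where "bq_im w = Quat (Im (b0 w)) (Im (b1 w)) (Im (b2 w)) (Im (b3 w))"

lemma bq_re_im_sel [simp]:
  "qRe (bq_re w) = Re (b0 w)" "qI (bq_re w) = Re (b1 w)" "qJ (bq_re w) = Re (b2 w)"
  "qK (bq_re w) = Re (b3 w)"
  "qRe (bq_im w) = Im (b0 w)" "qI (bq_im w) = Im (b1 w)" "qJ (bq_im w) = Im (b2 w)"
  "qK (bq_im w) = Im (b3 w)"
  by (simp_all add: bq_re_def bq_im_def)

lemma bq_eval_eq: "bq_eval I w = bq_re w + I * bq_im w"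
  by (simp add: bq_eval_def quat_eq_iff algebra_simps)

lemma bq_eval_add: "bq_eval I (v + w) = bq_eval I v + bq_eval I w"
  by (simp add: bq_eval_def slice_emb_add algebra_simps)

lemma bq_eval_bscalar [simp]: "bq_eval I (bscalar c) = slice_emb I c"
  by (simp add: bq_eval_def)

lemma bq_eval_bconst [simp]: "bq_eval I (bconst a) = a"
  by (simp add: bq_eval_eq quat_eq_iff)

lemma bq_eval_scalar_mult:
  "I \<in> imag_units \<Longrightarrow> bq_eval I (bscalar c * w) = slice_emb I c * bq_eval I w"
  by (simp add: bq_eval_def slice_emb_mult algebra_simps)

text \<open>Evaluation is not multiplicative, since \<open>I\<close> does not commute with quaternions. The defect is
  what the \<open>star\<close>-product corrects: the complex unit of the right factor becomes \<open>I\<close> on the far left.\<close>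

lemma bq_eval_mult:
  assumes "I \<in> imag_units"
  shows "bq_eval I (v * w) = bq_eval I v * bq_re w + I * bq_eval I v * bq_im w"
proof -
  have re: "bq_re (v * w) = bq_re v * bq_re w - bq_im v * bq_im w"
    and im: "bq_im (v * w) = bq_re v * bq_im w + bq_im v * bq_re w"
    by (simp_all add: quat_eq_iff algebra_simps)
  have "I * (I * x) = - x" for x
    using imag_units_mult_self[OF assms] by (simp flip: mult.assoc)
  then show ?thesis
    by (simp add: bq_eval_eq re im algebra_simps)
qed

lemma bq_eval_bcnj: "bq_eval (- I) (bcnj w) = bq_eval I w"
  by (simp add: bq_eval_def slice_emb_uminus_unit)

text \<open>The values at \<open>I\<close> and \<open>- I\<close> recover the two parts as half of their sum and difference.\<close>

lemma bq_eval_inject: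
  assumes "I \<in> imag_units" "bq_eval I v = bq_eval I w" "bq_eval (- I) v = bq_eval (- I) w"
  shows "v = w"
proof -
  have "bq_re v + I * bq_im v = bq_re w + I * bq_im w" "bq_re v - I * bq_im v = bq_re w - I * bq_im w"
    using assms(2,3) by (simp_all add: bq_eval_eq)
  then have "(bq_re v + I * bq_im v) + (bq_re v - I * bq_im v)
      = (bq_re w + I * bq_im w) + (bq_re w - I * bq_im w)"
    "(bq_re v + I * bq_im v) - (bq_re v - I * bq_im v)
      = (bq_re w + I * bq_im w) - (bq_re w - I * bq_im w)"
    by (simp_all only:)
  then have "2 *\<^sub>R bq_re v = 2 *\<^sub>R bq_re w" "2 *\<^sub>R (I * bq_im v) = 2 *\<^sub>R (I * bq_im w)"
    by (simp_all add: scaleR_2)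
  then have "bq_re v = bq_re w" "I * bq_im v = I * bq_im w"
    by simp_all
  moreover have "I \<noteq> 0"
    using assms(1) by (auto simp: imag_units_def)
  ultimately have "bq_re v = bq_re w" "bq_im v = bq_im w"
    by simp_all
  then show ?thesis
    by (simp add: biquat_eq_iff quat_eq_iff complex_eq_iff)
qed

section \<open>Slice regular functions and holomorphic stem functions\<close>

abbreviation bcoords :: "(biquat \<Rightarrow> complex) set"
  where "bcoords \<equiv> {b0, b1, b2, b3}"

definition bholomorphic_on :: "(complex \<Rightarrow> biquat) \<Rightarrow> complex set \<Rightarrow> bool"
  where "bholomorphic_on \<phi> A \<longleftrightarrow> (\<forall>c\<in>bcoords. (\<lambda>z. c (\<phi> z)) holomorphic_on A)"

definition stem_symmetric :: "(complex \<Rightarrow> biquat) \<Rightarrow> bool"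
  where "stem_symmetric \<phi> \<longleftrightarrow> (\<forall>z. \<phi> (cnj z) = bcnj (\<phi> z))"

text \<open>The slice function of a symmetric \<open>\<phi>\<close>, read off in the upper half plane.\<close>

definition induced_fun :: "(complex \<Rightarrow> biquat) \<Rightarrow> quat \<Rightarrow> quat"
  where "induced_fun \<phi> q = bq_eval (slice_unit q) (\<phi> (slice_coord q))"

lemma slice_emb_inj_unit: "slice_emb J z = slice_emb I z \<Longrightarrow> Im z \<noteq> 0 \<Longrightarrow> J = I"
  by (simp add: quat_eq_iff)

text \<open>Symmetry of \<open>\<phi>\<close> makes the two representations \<open>x + Iy = x + (-I)(-y)\<close> of a point give the same value,
  and at a real point it makes the imaginary part vanish, so that the unit does not matter.\<close>

lemma induced_fun_slice_emb:
  assumes "stem_symmetric \<phi>" "I \<in> imag_units"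
  shows "induced_fun \<phi> (slice_emb I z) = bq_eval I (\<phi> z)"
proof -
  define J where "J = slice_unit (slice_emb I z)"
  define w where "w = slice_coord (slice_emb I z)"
  have eq: "slice_emb J w = slice_emb I z"
    by (simp add: J_def w_def)
  have "bq_eval J (\<phi> w) = bq_eval I (\<phi> z)"
  proof (cases "Im z = 0")
    case True
    then have z: "cnj z = z"
      by (simp add: complex_eq_iff)
    then have "\<phi> z = bcnj (\<phi> z)"
      using assms(1) unfolding stem_symmetric_def by metis
    then have "bq_im (\<phi> z) = 0"
      by (auto simp: quat_eq_iff biquat_eq_iff complex_eq_iff)
    moreover have "w = z"
      using True assms(2) by (simp add: w_def slice_coord_slice_emb complex_eq_iff)
    ultimately show ?thesis
      by (simp add: bq_eval_eq)
  next
    case False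
    have "w = z \<or> w = cnj z"
      using slice_coord_eqD[OF assms(2) w_def[symmetric]] by auto
    then show ?thesis
    proof
      assume "w = z"
      with eq False have "J = I"
        by (simp add: slice_emb_inj_unit)
      with \<open>w = z\<close> show ?thesis
        by simp
    next
      assume w: "w = cnj z"
      with eq have "slice_emb (- J) z = slice_emb I z"
        by (simp add: slice_emb_uminus_unit)
      from slice_emb_inj_unit[OF this False] have "- J = I" .
      then have "J = - I"
        by auto
      then show ?thesis
        using w assms(1) by (simp add: stem_symmetric_def bq_eval_bcnj)
    qed
  qed
  then show ?thesis
    by (simp add: induced_fun_def J_def w_def)
qed

definition has_stem :: "(quat \<Rightarrow> quat) \<Rightarrow> quat set \<Rightarrow> (complex \<Rightarrow> biquat) \<Rightarrow> bool"
  where "has_stem f U \<phi> \<longleftrightarrow>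
    (\<forall>I\<in>imag_units. \<forall>z\<in>stem_dom U. f (slice_emb I z) = bq_eval I (\<phi> z))"

lemma has_stem_induced_fun: "stem_symmetric \<phi> \<Longrightarrow> has_stem (induced_fun \<phi>) U \<phi>"
  by (simp add: has_stem_def induced_fun_slice_emb)

lemma bounded_linear_Complex_pair: "bounded_linear (\<lambda>p. Complex (fst p) (snd p))"
  unfolding Complex_eq
  by (intro bounded_linear_add bounded_linear_const_mult
      bounded_linear_compose[OF bounded_linear_of_real] bounded_linear_fst bounded_linear_snd)

lemma bq_eval_has_derivative:
  assumes "\<And>c. c \<in> bcoords \<Longrightarrow> ((\<lambda>z. c (\<phi> z)) has_field_derivative c w) (at (Complex x y))"
  shows "((\<lambda>p. bq_eval I (\<phi> (Complex (fst p) (snd p)))) has_derivative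
    (\<lambda>p. bq_eval I (bscalar (Complex (fst p) (snd p)) * w))) (at (x, y))"
proof -
  have pair: "((\<lambda>p. Complex (fst p) (snd p)) has_derivative (\<lambda>p. Complex (fst p) (snd p))) (at (x, y))"
    by (rule bounded_linear.has_derivative[OF bounded_linear_Complex_pair has_derivative_ident])
  have c: "((\<lambda>p. c (\<phi> (Complex (fst p) (snd p)))) has_derivative
      (\<lambda>p. c w * Complex (fst p) (snd p))) (at (x, y))" if "c \<in> bcoords" for c
    using has_derivative_compose[OF pair, of "\<lambda>z. c (\<phi> z)" "\<lambda>h. c w * h"] assms[OF that]
    by (simp add: has_field_derivative_def)
  have s: "((\<lambda>p. slice_emb I (c (\<phi> (Complex (fst p) (snd p)))) * e) has_derivative
      (\<lambda>p. slice_emb I (c w * Complex (fst p) (snd p)) * e)) (at (x, y))" if "c \<in> bcoords" for c e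
    by (intro has_derivative_mult_left bounded_linear.has_derivative[OF bounded_linear_slice_emb]
        c that)
  show ?thesis
    unfolding bq_eval_def
    using has_derivative_add[OF has_derivative_add[OF has_derivative_add[OF
          s[of b0 1] s[of b1 quat_i]] s[of b2 quat_j]] s[of b3 quat_k]]
    by (simp add: mult.commute)
qed

text \<open>Along a slice the derivative of \<open>bq_eval I \<circ> \<phi>\<close> is multiplication by the complex increment inside
  \<open>bq_eval I\<close>; the increment \<open>\<i>\<close> comes out as \<open>I\<close> on the left, which is the Cauchy-Riemann condition
  of slice regularity.\<close>

lemma slice_regular_on_if_stem:
  assumes U: "open U" "circular U"
    and \<phi>: "stem_symmetric \<phi>" "bholomorphic_on \<phi> (stem_dom U)" and f: "has_stem f U \<phi>"
  shows "slice_regular_on f U"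
  unfolding slice_regular_on_def
proof (rule conjI, rule exI[of _ "\<lambda>x y. bq_re (\<phi> (Complex x y))"],
    rule exI[of _ "\<lambda>x y. bq_im (\<phi> (Complex x y))"]; intro allI ballI impI conjI)
  fix x y I assume I: "I \<in> imag_units" and "slice_pt I x y \<in> U"
  then have z: "Complex x y \<in> stem_dom U"
    using U by (simp add: slice_pt_eq_slice_emb slice_emb_mem_iff)
  have "\<phi> (Complex x (- y)) = bcnj (\<phi> (Complex x y))"
    using \<phi>(1) by (metis complex_cnj stem_symmetric_def)
  then show "bq_re (\<phi> (Complex x (- y))) = bq_re (\<phi> (Complex x y))"
    "bq_im (\<phi> (Complex x (- y))) = - bq_im (\<phi> (Complex x y))"
    by (simp_all add: quat_eq_iff)
  show "f (slice_pt I x y) = bq_re (\<phi> (Complex x y)) + I * bq_im (\<phi> (Complex x y))"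
    using f I z by (simp add: has_stem_def slice_pt_eq_slice_emb bq_eval_eq)
next
  fix x y I assume I: "I \<in> imag_units" and "slice_pt I x y \<in> U"
  then have z: "Complex x y \<in> stem_dom U"
    using U by (simp add: slice_pt_eq_slice_emb slice_emb_mem_iff)
  have op: "open (stem_dom U)"
    by (rule open_stem_dom[OF U(1)])
  define w where "w = (let d = (\<lambda>c. deriv (\<lambda>z. c (\<phi> z)) (Complex x y)) in Biquat (d b0) (d b1) (d b2) (d b3))"
  define D where "D = (\<lambda>p. bq_eval I (bscalar (Complex (fst p) (snd p)) * w))"
  have "((\<lambda>z. c (\<phi> z)) has_field_derivative c w) (at (Complex x y))" if "c \<in> bcoords" for c
    using that \<phi>(2) holomorphic_derivI[OF _ op z]
    by (auto simp: bholomorphic_on_def w_def)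
  then have "((\<lambda>p. bq_eval I (\<phi> (Complex (fst p) (snd p)))) has_derivative D) (at (x, y))"
    unfolding D_def by (rule bq_eval_has_derivative)
  moreover have "open ((\<lambda>p. Complex (fst p) (snd p)) -` stem_dom U)"
    by (intro open_vimage op linear_continuous_on bounded_linear_Complex_pair)
  ultimately have D: "((\<lambda>(u, v). f (slice_pt I u v)) has_derivative D) (at (x, y))"
    by (rule has_derivative_transform_within_open)
      (use f I z in \<open>auto simp: has_stem_def slice_pt_eq_slice_emb\<close>)
  have "D (0, 1) = I * D (1, 0)"
  proof -
    have "slice_emb I \<i> = I"
      using I by (simp add: quat_eq_iff imag_units_iff)
    moreover have "Complex 0 1 = \<i>" "Complex 1 0 = 1"
      by (simp_all add: complex_eq_iff)
    ultimately show ?thesis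
      using I by (simp add: D_def bq_eval_scalar_mult)
  qed
  then have "D (1, 0) + I * D (0, 1) = 0"
    using imag_units_mult_self[OF I] by (simp flip: mult.assoc)
  with D show "\<exists>D. ((\<lambda>(u, v). f (slice_pt I u v)) has_derivative D) (at (x, y)) \<and>
      (1 / 2) *\<^sub>R (D (1, 0) + I * D (0, 1)) = 0"
    by auto
qed

lemma has_field_derivative_Cauchy_Riemann:
  fixes G1 G2 :: "real \<times> real \<Rightarrow> real"
  assumes "(G1 has_derivative D1) (at (Re z, Im z))" "(G2 has_derivative D2) (at (Re z, Im z))"
    and CR: "D1 (0, 1) = - D2 (1, 0)" "D2 (0, 1) = D1 (1, 0)"
  shows "((\<lambda>z. Complex (G1 (Re z, Im z)) (G2 (Re z, Im z))) has_field_derivative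
    Complex (D1 (1, 0)) (D2 (1, 0))) (at z)"
proof -
  have lin: "D (a, b) = a * D (1, 0) + b * D (0, 1)" if "linear D" for D :: "real \<times> real \<Rightarrow> real" and a b
  proof -
    have "D (a, b) = D (a *\<^sub>R (1, 0) + b *\<^sub>R (0, 1))"
      by simp
    also have "\<dots> = a * D (1, 0) + b * D (0, 1)"
      using that by (simp only: linear_add linear_cmul) simp
    finally show ?thesis .
  qed
  have "linear D1" "linear D2"
    using assms(1,2) by (simp_all add: has_derivative_linear)
  note lins = this[THEN lin]
  have pr: "((\<lambda>z. (Re z, Im z)) has_derivative (\<lambda>z. (Re z, Im z))) (at z)"
    by (intro has_derivative_Pair bounded_linear.has_derivative[OF bounded_linear_Re]
        bounded_linear.has_derivative[OF bounded_linear_Im] has_derivative_ident)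
  have "((\<lambda>z. of_real (G1 (Re z, Im z)) + \<i> * of_real (G2 (Re z, Im z))) has_derivative
      (\<lambda>h. of_real (D1 (Re h, Im h)) + \<i> * of_real (D2 (Re h, Im h)))) (at z)"
    by (rule has_derivative_add[OF bounded_linear.has_derivative[OF bounded_linear_of_real
            has_derivative_compose[OF pr assms(1)]]
          has_derivative_mult_right[OF bounded_linear.has_derivative[OF bounded_linear_of_real
            has_derivative_compose[OF pr assms(2)]]]])
  moreover have "of_real (D1 (Re h, Im h)) + \<i> * of_real (D2 (Re h, Im h))
      = Complex (D1 (1, 0)) (D2 (1, 0)) * h" for h
    by (simp add: complex_eq_iff lins[of "Re h" "Im h"] CR algebra_simps)
  ultimately show ?thesis
    by (simp add: has_field_derivative_def Complex_eq)
qed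

definition biquat_of_parts :: "quat \<Rightarrow> quat \<Rightarrow> biquat"
  where "biquat_of_parts a b = Biquat (Complex (qRe a) (qRe b)) (Complex (qI a) (qI b))
    (Complex (qJ a) (qJ b)) (Complex (qK a) (qK b))"

lemma bq_eval_biquat_of_parts [simp]: "bq_eval I (biquat_of_parts a b) = a + I * b"
  by (simp add: biquat_of_parts_def bq_eval_eq quat_eq_iff)

text \<open>For a fixed unit \<open>I\<close>, \<open>F1\<close> and \<open>F2\<close> are linear combinations of \<open>f (x + Iy)\<close> and
  \<open>f (x - Iy)\<close>. They inherit differentiability, and the two conditions for the units \<open>I\<close> and \<open>- I\<close>
  combine to the Cauchy-Riemann equations for each coordinate of \<open>F1 + \<iota> F2\<close>.\<close>

lemma slice_regular_on_imp_stem: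
  assumes U: "open U" "circular U" and reg: "slice_regular_on f U"
  obtains \<phi> where "stem_symmetric \<phi>" "bholomorphic_on \<phi> (stem_dom U)" "has_stem f U \<phi>"
proof -
  from reg obtain F1 F2 where F: "\<And>x y I. I \<in> imag_units \<Longrightarrow> slice_pt I x y \<in> U \<Longrightarrow>
      F1 x (- y) = F1 x y \<and> F2 x (- y) = - F2 x y \<and> f (slice_pt I x y) = F1 x y + I * F2 x y"
    unfolding slice_regular_on_def by metis
  have diff: "\<exists>D. ((\<lambda>(u, v). f (slice_pt I u v)) has_derivative D) (at (x, y)) \<and>
      D (1, 0) = - (I * D (0, 1))" if "I \<in> imag_units" "slice_pt I x y \<in> U" for I x y
  proof -
    from reg that obtain D where D: "((\<lambda>(u, v). f (slice_pt I u v)) has_derivative D) (at (x, y))"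
      and "(1 / 2) *\<^sub>R (D (1, 0) + I * D (0, 1)) = 0"
      unfolding slice_regular_on_def by metis
    then have "D (1, 0) + I * D (0, 1) = 0"
      by simp
    then have "D (1, 0) = - (I * D (0, 1))"
      by (simp add: eq_neg_iff_add_eq_0)
    with D show ?thesis
      by blast
  qed
  \<comment> \<open>Outside the domain \<open>F1\<close> and \<open>F2\<close> need not have any parity; the value 0 keeps \<open>\<phi>\<close> symmetric
    on the whole plane.\<close>
  define \<phi> where "\<phi> z = (if z \<in> stem_dom U then biquat_of_parts (F1 (Re z) (Im z)) (F2 (Re z) (Im z)) else 0)"
    for z
  have mem: "slice_pt I (Re z) (Im z) \<in> U" if "I \<in> imag_units" "z \<in> stem_dom U" for I z
    using that U by (simp add: slice_emb_mem_iff flip: slice_emb_def)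
  show ?thesis
  proof
    show stem: "has_stem f U \<phi>"
      using F mem by (auto simp: has_stem_def \<phi>_def slice_emb_def)
    show "stem_symmetric \<phi>"
      unfolding stem_symmetric_def
    proof
      fix z
      show "\<phi> (cnj z) = bcnj (\<phi> z)"
      proof (cases "z \<in> stem_dom U")
        case True
        from F[OF _ mem[OF _ True], of quat_i] True show ?thesis
          using U(2) by (simp add: \<phi>_def cnj_mem_stem_dom_iff biquat_eq_iff biquat_of_parts_def
              complex_eq_iff)
      next
        case False
        then show ?thesis
          using U(2) by (simp add: \<phi>_def cnj_mem_stem_dom_iff biquat_eq_iff)
      qed
    qed
    have op: "open (stem_dom U)"
      by (rule open_stem_dom[OF U(1)])
    have "(\<lambda>z. Complex (k (F1 (Re z) (Im z))) (k (F2 (Re z) (Im z)))) holomorphic_on stem_dom U"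
      if k: "bounded_linear k" for k :: "quat \<Rightarrow> real"
      unfolding holomorphic_on_open[OF op]
    proof
      fix z assume z: "z \<in> stem_dom U"
      let ?I = quat_i
      have II: "?I * (?I * q) = - q" for q
        by (simp add: quat_eq_iff)
      have units: "?I \<in> imag_units" "- ?I \<in> imag_units"
        by (simp_all add: imag_units_uminus)
      define f1 where "f1 = (\<lambda>(u, v). f (slice_pt ?I u v))"
      define f2 where "f2 = (\<lambda>(u, v). f (slice_pt (- ?I) u v))"
      obtain D1 where D1: "(f1 has_derivative D1) (at (Re z, Im z))" "D1 (1, 0) = - (?I * D1 (0, 1))"
        unfolding f1_def using diff[OF units(1) mem[OF units(1) z]] by blast
      obtain D2 where D2: "(f2 has_derivative D2) (at (Re z, Im z))" "D2 (1, 0) = ?I * D2 (0, 1)"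
        unfolding f2_def using diff[OF units(2) mem[OF units(2) z]] by auto
      \<comment> \<open>\<open>g1\<close> and \<open>g2\<close> express \<open>F1\<close> and \<open>F2\<close> by \<open>f\<close>, but are differentiable by construction.\<close>
      define g1 where "g1 p = (1 / 2) *\<^sub>R (f1 p + f2 p)" for p
      define g2 where "g2 p = (- 1 / 2) *\<^sub>R (?I * (f1 p - f2 p))" for p
      define E1 where "E1 p = (1 / 2) *\<^sub>R (D1 p + D2 p)" for p
      define E2 where "E2 p = (- 1 / 2) *\<^sub>R (?I * (D1 p - D2 p))" for p
      have g: "(g1 has_derivative E1) (at (Re z, Im z))" "(g2 has_derivative E2) (at (Re z, Im z))"
        unfolding g1_def g2_def E1_def E2_def
        by (intro has_derivative_scaleR_right has_derivative_mult_right has_derivative_add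
            has_derivative_diff D1 D2)+
      have "((\<lambda>z. Complex (k (g1 (Re z, Im z))) (k (g2 (Re z, Im z)))) has_field_derivative
          Complex (k (E1 (1, 0))) (k (E2 (1, 0)))) (at z)"
      proof (rule has_field_derivative_Cauchy_Riemann[where ?D1.0 = "\<lambda>p. k (E1 p)" and ?D2.0 = "\<lambda>p. k (E2 p)"])
        show "((\<lambda>a. k (g1 a)) has_derivative (\<lambda>p. k (E1 p))) (at (Re z, Im z))"
          "((\<lambda>a. k (g2 a)) has_derivative (\<lambda>p. k (E2 p))) (at (Re z, Im z))"
          using g k by (auto intro: bounded_linear.has_derivative)
        have "E1 (0, 1) = - E2 (1, 0)" "E2 (0, 1) = E1 (1, 0)"
          using D1(2) D2(2) by (simp_all add: E1_def E2_def II algebra_simps)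
        then show "k (E1 (0, 1)) = - k (E2 (1, 0))" "k (E2 (0, 1)) = k (E1 (1, 0))"
          using k by (simp_all add: linear_neg bounded_linear.linear)
      qed
      then have "((\<lambda>z. Complex (k (F1 (Re z) (Im z))) (k (F2 (Re z) (Im z)))) has_field_derivative
          Complex (k (E1 (1, 0))) (k (E2 (1, 0)))) (at z)"
      proof (rule DERIV_cong_ev[THEN iffD1, rotated -1])
        show "z = z" "Complex (k (E1 (1, 0))) (k (E2 (1, 0))) = Complex (k (E1 (1, 0))) (k (E2 (1, 0)))"
          by simp_all
        have "g1 (Re w, Im w) = F1 (Re w) (Im w)" "g2 (Re w, Im w) = F2 (Re w) (Im w)"
          if "w \<in> stem_dom U" for w
        proof -
          have "f1 (Re w, Im w) = F1 (Re w) (Im w) + ?I * F2 (Re w) (Im w)"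
            "f2 (Re w, Im w) = F1 (Re w) (Im w) - ?I * F2 (Re w) (Im w)"
            using F[OF units(1) mem[OF units(1) that]] F[OF units(2) mem[OF units(2) that]]
            by (simp_all add: f1_def f2_def)
          then show "g1 (Re w, Im w) = F1 (Re w) (Im w)" "g2 (Re w, Im w) = F2 (Re w) (Im w)"
            by (simp_all add: g1_def g2_def quat_eq_iff)
        qed
        then show "\<forall>\<^sub>F w in nhds z. Complex (k (g1 (Re w, Im w))) (k (g2 (Re w, Im w)))
            = Complex (k (F1 (Re w) (Im w))) (k (F2 (Re w) (Im w)))"
          using eventually_nhds_in_open[OF op z] by (auto elim: eventually_mono)
      qed
      then show "\<exists>f'. ((\<lambda>z. Complex (k (F1 (Re z) (Im z))) (k (F2 (Re z) (Im z))))
          has_field_derivative f') (at z)"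
        by blast
    qed
    note this[OF bounded_linear_quat_coords(1)] this[OF bounded_linear_quat_coords(2)]
      this[OF bounded_linear_quat_coords(3)] this[OF bounded_linear_quat_coords(4)]
    then show "bholomorphic_on \<phi> (stem_dom U)"
      unfolding bholomorphic_on_def
      by (auto simp: \<phi>_def biquat_of_parts_def cong: holomorphic_cong)
  qed
qed

text \<open>Conjugating the slice point by \<open>a = f q\<close> replaces \<open>I\<close> by \<open>J = a\<^sup>-\<^sup>1 I a\<close>, which is again an imaginary
  unit; then \<open>a J = I a\<close> moves the unit to the left as in \<open>bq_eval_mult\<close>.\<close>

lemma star_eval:
  assumes "I \<in> imag_units"
    and f: "f (slice_emb I z) = bq_eval I v"
    and g: "\<And>J. J \<in> imag_units \<Longrightarrow> g (slice_emb J z) = bq_eval J w"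
  shows "star f g (slice_emb I z) = bq_eval I (v * w)"
proof (cases "f (slice_emb I z) = 0")
  case True
  then show ?thesis
    using f bq_eval_mult[OF assms(1), of v w] by (simp add: star_def)
next
  case False
  define a where "a = f (slice_emb I z)"
  define J where "J = inverse a * I * a"
  have a: "a \<noteq> 0" "bq_eval I v = a"
    using False f by (simp_all add: a_def)
  have "J * J = inverse a * I * (a * inverse a) * I * a"
    by (simp add: J_def mult.assoc)
  also have "\<dots> = inverse a * (I * I) * a"
    using a by (simp add: mult.assoc)
  also have "\<dots> = - 1"
    using a imag_units_mult_self[OF assms(1)] by simp
  finally have J: "J \<in> imag_units"
    by (simp add: imag_units_def power2_eq_square)
  have "inverse a * slice_emb I z * a = inverse a * of_real (Re z) * a + inverse a * I * of_real (Im z) * a"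
    by (simp add: slice_emb_def slice_pt_def algebra_simps)
  also have "\<dots> = slice_emb J z"
    using a by (simp add: slice_emb_def slice_pt_def J_def mult.assoc of_real_def)
  finally have "star f g (slice_emb I z) = a * bq_eval J w"
    using a g[OF J] by (simp add: star_def flip: a_def)
  also have "\<dots> = a * bq_re w + a * J * bq_im w"
    by (simp add: bq_eval_eq algebra_simps)
  also have "a * J = I * a"
    using a by (simp add: J_def flip: mult.assoc)
  finally show ?thesis
    using bq_eval_mult[OF assms(1)] a by simp
qed

section \<open>Semi-regular functions and meromorphic stem functions\<close>

lemma bholomorphic_on_subset: "bholomorphic_on \<phi> A \<Longrightarrow> B \<subseteq> A \<Longrightarrow> bholomorphic_on \<phi> B"
  unfolding bholomorphic_on_def by (meson holomorphic_on_subset)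

lemma bholomorphic_on_add:
  "bholomorphic_on \<phi> A \<Longrightarrow> bholomorphic_on \<psi> A \<Longrightarrow> bholomorphic_on (\<lambda>z. \<phi> z + \<psi> z) A"
  by (auto simp: bholomorphic_on_def intro!: holomorphic_intros)

lemma bholomorphic_on_mult:
  "bholomorphic_on \<phi> A \<Longrightarrow> bholomorphic_on \<psi> A \<Longrightarrow> bholomorphic_on (\<lambda>z. \<phi> z * \<psi> z) A"
  by (auto simp: bholomorphic_on_def intro!: holomorphic_intros)

text \<open>\<open>qdelta p\<close> has real coefficients, so it acts on every slice as the same complex polynomial, whose
  roots are the two points of the sphere of \<open>p\<close> in the plane.\<close>

lemma qdelta_slice_emb:
  assumes "I \<in> imag_units" "slice_coord p = w \<or> slice_coord p = cnj w"
  shows "qdelta p (slice_emb I z) = slice_emb I ((z - w) * (z - cnj w))"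
proof -
  have re: "qRe p = Re w"
    using assms(2) by (auto simp: slice_coord_def complex_eq_iff)
  have "(norm p)\<^sup>2 = (Re (slice_coord p))\<^sup>2 + (Im (slice_coord p))\<^sup>2"
    unfolding Im_slice_coord_square
    by (simp add: norm_quat_def inner_quat_def slice_coord_def power2_eq_square)
  then have n: "(norm p)\<^sup>2 = (Re w)\<^sup>2 + (Im w)\<^sup>2"
    using assms(2) by (auto simp: power2_eq_square)
  have "(z - w) * (z - cnj w) = z * z - of_real (2 * Re w) * z + of_real ((Re w)\<^sup>2 + (Im w)\<^sup>2)"
    by (simp add: complex_eq_iff power2_eq_square algebra_simps)
  then show ?thesis
    using assms(1)
    by (simp only: qdelta_def re n[unfolded power2_eq_square] slice_emb_add slice_emb_diff slice_emb_mult slice_emb_of_real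
        power2_eq_square)
qed

text \<open>This is stated for all large exponents so that one exponent can serve finitely many functions and
  points. The order of \<open>f\<close> at \<open>w\<close> gives the bound; if \<open>f\<close> vanishes near \<open>w\<close>, it has no order and every
  exponent works.\<close>

lemma meromorphic_clear_pole:
  assumes "f meromorphic_on {w}"
  shows "\<forall>\<^sub>F n in sequentially. \<exists>l. ((\<lambda>z. (z - w) ^ n * f z) \<longlongrightarrow> l) (at w)"
proof (cases "\<exists>\<^sub>F z in at w. f z \<noteq> 0")
  case False
  then have "((\<lambda>z. (z - w) ^ n * f z) \<longlongrightarrow> 0) (at w)" for n
    by (intro tendsto_eventually) (auto simp: frequently_def elim: eventually_mono)
  then show ?thesis
    by (intro always_eventually) blast
next
  case True
  define k where "k = zorder f w"
  define g where "g = zor_poly f w"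
  have "isolated_singularity_at f w" "not_essential f w"
    using assms by (simp_all add: meromorphic_at_iff)
  from zorder_exist[OF this True] obtain r where r: "r > 0" "g holomorphic_on cball w r"
    "\<And>z. z \<in> cball w r - {w} \<Longrightarrow> f z = g z * (z - w) powi k"
    unfolding k_def g_def by blast
  have "\<exists>l. ((\<lambda>z. (z - w) ^ n * f z) \<longlongrightarrow> l) (at w)" if n: "n \<ge> nat (- k)" for n
  proof
    have "continuous_on (ball w r) g"
      using r(2) by (meson ball_subset_cball continuous_on_subset holomorphic_on_imp_continuous_on)
    then have "isCont g w"
      using r(1) by (simp add: continuous_on_eq_continuous_at)
    then have lim: "((\<lambda>z. (z - w) ^ nat (int n + k) * g z) \<longlongrightarrow> (w - w) ^ nat (int n + k) * g w) (at w)"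
      by (intro tendsto_intros) (simp add: isCont_def)
    have "\<forall>\<^sub>F z in at w. z \<in> ball w r - {w}"
      using r(1) by (intro eventually_at_in_open) auto
    then have "\<forall>\<^sub>F z in at w. (z - w) ^ nat (int n + k) * g z = (z - w) ^ n * f z"
    proof eventually_elim
      case (elim z)
      have "(z - w) ^ nat (int n + k) = (z - w) powi (int n + k)"
        using n by (simp add: power_int_def)
      also have "\<dots> = (z - w) ^ n * (z - w) powi k"
        using elim by (subst power_int_add) auto
      finally show ?case
        using elim r(3)[of z] by simp
    qed
    with lim show "((\<lambda>z. (z - w) ^ n * f z) \<longlongrightarrow> (w - w) ^ nat (int n + k) * g w) (at w)"
      by (rule Lim_transform_eventually)
  qed
  then show ?thesis
    unfolding eventually_sequentially by blast
qed

lemma open_analytic_points: "open {z. f analytic_on {z}}"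
proof (subst open_subopen, intro ballI)
  fix z assume "z \<in> {z. f analytic_on {z}}"
  then obtain S where "open S" "z \<in> S" "f holomorphic_on S"
    by (auto simp: analytic_at)
  then show "\<exists>T. open T \<and> z \<in> T \<and> T \<subseteq> {z. f analytic_on {z}}"
    by (intro exI[of _ S]) (auto simp: analytic_at)
qed

lemma analytic_at_cnj:
  assumes "f analytic_on {z}" "\<And>w. f (cnj w) = cnj (f w)"
  shows "f analytic_on {cnj z}"
proof -
  from assms(1) obtain S where S: "open S" "z \<in> S" "f holomorphic_on S"
    by (auto simp: analytic_at)
  have "open (cnj -` S)"
    using S(1) by (intro open_vimage continuous_on_cnj continuous_on_id)
  moreover have "x \<in> cnj ` (cnj -` S)" if "x \<in> S" for x
    using that by (intro image_eqI[of _ _ "cnj x"]) simp_all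
  then have "cnj ` (cnj -` S) = S"
    by auto
  ultimately have "cnj \<circ> f \<circ> cnj holomorphic_on cnj -` S"
    using S(3) by (intro holomorphic_on_compose_cnj_cnj) simp_all
  moreover have "cnj \<circ> f \<circ> cnj = f"
    by (simp add: fun_eq_iff assms(2))
  ultimately show ?thesis
    using \<open>open (cnj -` S)\<close> S(2) by (auto simp: analytic_at)
qed

locale circular_region =
  fixes \<Omega> :: "quat set"
  assumes circular_domain: "circular_domain \<Omega>"
begin

abbreviation D :: "complex set" where "D \<equiv> stem_dom \<Omega>"

lemma open_\<Omega>: "open \<Omega>" and circular_\<Omega>: "circular \<Omega>"
  using circular_domain by (auto simp: circular_domain_def)

lemma open_D: "open D"
  by (rule open_stem_dom[OF open_\<Omega>])

lemma cnj_mem_D [simp]: "cnj z \<in> D \<longleftrightarrow> z \<in> D"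
  by (rule cnj_mem_stem_dom_iff[OF circular_\<Omega>])

text \<open>Symmetry is required on the whole plane, and not only on \<open>D\<close>, to keep domain conditions out of the
  computations with \<open>induced_fun\<close>.\<close>

definition stem :: "(complex \<Rightarrow> biquat) \<Rightarrow> bool"
  where "stem \<phi> \<longleftrightarrow> stem_symmetric \<phi> \<and> (\<forall>c\<in>bcoords. (\<lambda>z. c (\<phi> z)) meromorphic_on D)"

text \<open>The stem of a particular representative: it computes \<open>f\<close> at every point where \<open>f\<close> is defined, in
  contrast to \<open>agrees\<close> below, which allows exceptional points.\<close>

definition stem_on :: "(complex \<Rightarrow> biquat) \<Rightarrow> qpfun \<Rightarrow> bool"
  where "stem_on \<phi> f \<longleftrightarrow> stem \<phi> \<and> bholomorphic_on \<phi> (stem_dom (dom f))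
    \<and> has_stem (\<lambda>q. the (f q)) (dom f) \<phi> \<and> (\<forall>\<^sub>\<approx>z\<in>D. z \<in> stem_dom (dom f))"

text \<open>Off the sphere of \<open>p\<close>, the stem of \<open>h = qdelta p ^ m * f\<close> is \<open>((z - w) * (z - cnj w)) ^ m\<close> times \<open>\<phi>\<close>; so
  near \<open>w\<close> each coordinate of \<open>\<phi>\<close> is a holomorphic function divided by a polynomial.\<close>

lemma pole_or_removable_imp_meromorphic:
  assumes pole: "pole_or_removable \<Omega> f p" and p: "slice_coord p = w \<or> slice_coord p = cnj w"
    and f: "open (dom f)" "circular (dom f)" "has_stem (\<lambda>q. the (f q)) (dom f) \<phi>"
  shows "\<forall>\<^sub>F z in at w. z \<in> stem_dom (dom f)" "c \<in> bcoords \<Longrightarrow> (\<lambda>z. c (\<phi> z)) meromorphic_on {w}"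
proof -
  from pole obtain V m h where V: "open V" "circular V" "qsphere p \<subseteq> V"
    "V - qsphere p \<subseteq> dom f" "slice_regular_on h V"
    and h: "\<And>q. q \<in> V - qsphere p \<Longrightarrow> h q = qdelta p q ^ m * the (f q)"
    unfolding pole_or_removable_def by blast
  obtain \<xi> where \<xi>: "bholomorphic_on \<xi> (stem_dom V)" "has_stem h V \<xi>"
    using slice_regular_on_imp_stem[OF V(1,2,5)] by blast
  have opV: "open (stem_dom V)"
    by (rule open_stem_dom[OF V(1)])
  have "p \<in> V"
    using V(3) by (auto simp: qsphere_eq)
  then have w: "w \<in> stem_dom V"
    using slice_coord_mem_iff[OF V(2)] cnj_mem_stem_dom_iff[OF V(2)] p by metis
  have V_diff: "slice_emb I z \<in> V - qsphere p"
    if "I \<in> imag_units" "z \<in> stem_dom V - {w}" "z \<noteq> cnj w" for I z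
  proof -
    have "slice_coord (slice_emb I z) \<noteq> slice_coord p"
      using slice_coord_eqD[OF that(1)] that(2,3) p by fastforce
    then show ?thesis
      using that V(2) by (auto simp: qsphere_eq slice_emb_mem_iff)
  qed
  have ev: "\<forall>\<^sub>F z in at w. z \<in> stem_dom V - {w} \<and> z \<noteq> cnj w"
    by (intro eventually_conj eventually_at_in_open opV w eventually_neq_at_within)
  then show "\<forall>\<^sub>F z in at w. z \<in> stem_dom (dom f)"
  proof eventually_elim
    case (elim z)
    then show ?case
      using V_diff[of quat_i z] V(4) f(2) by (auto simp: stem_dom_def)
  qed
  assume c: "c \<in> bcoords"
  define d where "d z = (z - w) * (z - cnj w)" for z
  have "(\<lambda>z. c (\<xi> z)) analytic_on stem_dom V"
    using \<xi>(1) c opV by (auto simp: bholomorphic_on_def analytic_on_open)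
  then have "(\<lambda>z. c (\<xi> z)) meromorphic_on {w}"
    using w by (intro analytic_on_imp_meromorphic_on) (auto elim: analytic_on_subset)
  then have "(\<lambda>z. c (\<xi> z) / d z ^ m) meromorphic_on {w}"
    unfolding d_def by (intro meromorphic_intros)
  moreover have "\<forall>\<^sub>F z in at w. c (\<phi> z) = c (\<xi> z) / d z ^ m"
    using ev
  proof eventually_elim
    case (elim z)
    have "bq_eval I (\<xi> z) = bq_eval I (bscalar (d z ^ m) * \<phi> z)" if I: "I \<in> imag_units" for I
    proof -
      have mem: "slice_emb I z \<in> V - qsphere p"
        using V_diff[OF I] elim by auto
      then have "z \<in> stem_dom (dom f)"
        using I V(4) f(2) by (auto simp flip: slice_emb_mem_iff[OF f(2) I])
      then have "bq_eval I (\<phi> z) = the (f (slice_emb I z))"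
        using f(3) I by (simp add: has_stem_def)
      then show ?thesis
        using h[OF mem] \<xi>(2) I elim p
        by (simp add: has_stem_def bq_eval_scalar_mult qdelta_slice_emb[OF I p] slice_emb_power d_def)
    qed
    then have "\<xi> z = bscalar (d z ^ m) * \<phi> z"
      by (intro bq_eval_inject[of quat_i]) (simp_all add: imag_units_uminus)
    then have "c (\<xi> z) = d z ^ m * c (\<phi> z)"
      using c by auto
    moreover have "d z \<noteq> 0"
      using elim by (simp add: d_def)
    ultimately show ?case
      by simp
  qed
  then have "(\<lambda>z. c (\<phi> z)) meromorphic_on {w} \<longleftrightarrow> (\<lambda>z. c (\<xi> z) / d z ^ m) meromorphic_on {w}"
    by (intro meromorphic_on_cong) auto
  ultimately show "(\<lambda>z. c (\<phi> z)) meromorphic_on {w}"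
    by simp
qed

lemma semireg_funs_imp_stem:
  assumes "f \<in> semireg_funs \<Omega>"
  obtains \<phi> where "stem_on \<phi> f"
proof -
  from assms have f: "dom f \<subseteq> \<Omega>" "open (dom f)" "circular (dom f)"
    "slice_regular_on (\<lambda>q. the (f q)) (dom f)" "\<And>p. p \<in> \<Omega> - dom f \<Longrightarrow> pole_or_removable \<Omega> f p"
    by (auto simp: semireg_funs_def)
  obtain \<phi> where \<phi>: "stem_symmetric \<phi>" "bholomorphic_on \<phi> (stem_dom (dom f))"
    "has_stem (\<lambda>q. the (f q)) (dom f) \<phi>"
    using slice_regular_on_imp_stem[OF f(2-4)] by blast
  have op: "open (stem_dom (dom f))"
    by (rule open_stem_dom[OF f(2)])
  have loc: "(\<forall>\<^sub>F z in at w. z \<in> stem_dom (dom f)) \<and> (\<forall>c\<in>bcoords. (\<lambda>z. c (\<phi> z)) meromorphic_on {w})"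
    if w: "w \<in> D" for w
  proof (cases "w \<in> stem_dom (dom f)")
    case True
    have "(\<lambda>z. c (\<phi> z)) meromorphic_on {w}" if "c \<in> bcoords" for c
    proof -
      have "(\<lambda>z. c (\<phi> z)) analytic_on stem_dom (dom f)"
        using \<phi>(2) that op by (auto simp: bholomorphic_on_def analytic_on_open)
      then show ?thesis
        using True by (intro analytic_on_imp_meromorphic_on) (auto elim: analytic_on_subset)
    qed
    then show ?thesis
      using True op by (auto intro: eventually_at_in_open')
  next
    case False
    let ?p = "slice_emb quat_i w"
    have "?p \<in> \<Omega> - dom f"
      using w False by (auto simp: stem_dom_def)
    then have pole: "pole_or_removable \<Omega> f ?p"
      by (rule f(5))
    have "slice_coord ?p = w \<or> slice_coord ?p = cnj w"
      by (auto simp: slice_coord_slice_emb complex_eq_iff)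
    from pole_or_removable_imp_meromorphic[OF pole this f(2,3) \<phi>(3)] show ?thesis
      by blast
  qed
  have "(\<lambda>z. c (\<phi> z)) meromorphic_on D" if "c \<in> bcoords" for c
    using loc that by (subst meromorphic_on_meromorphic_at) blast
  moreover have "\<forall>\<^sub>\<approx>z\<in>D. z \<in> stem_dom (dom f)"
    using loc by (simp add: eventually_cosparse_open_eq[OF open_D])
  ultimately show ?thesis
    using \<phi> by (intro that[of \<phi>]) (simp add: stem_on_def stem_def)
qed

text \<open>Let \<open>w\<close> be the coordinate of \<open>p\<close>. A large power of \<open>(z - w) * (z - cnj w)\<close> clears the poles of all
  coordinates of \<open>\<phi>\<close> at \<open>w\<close> and at \<open>cnj w\<close> at once; the extended product is the stem of a regular
  function on the rotation of two small discs about these points.\<close>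

lemma stem_on_imp_pole_or_removable:
  assumes f: "dom f \<subseteq> \<Omega>" "open (dom f)" "circular (dom f)" and stem: "stem_on \<phi> f"
    and p: "p \<in> \<Omega> - dom f"
  shows "pole_or_removable \<Omega> f p"
proof -
  define w where "w = slice_coord p"
  let ?Df = "stem_dom (dom f)"
  have wD: "w \<in> D" and w_notin: "w \<notin> ?Df"
    using p slice_coord_mem_iff[OF circular_\<Omega>] slice_coord_mem_iff[OF f(3)] by (auto simp: w_def)
  have sym: "stem_symmetric \<phi>" and mero: "\<And>c. c \<in> bcoords \<Longrightarrow> (\<lambda>z. c (\<phi> z)) meromorphic_on D"
    and holo: "bholomorphic_on \<phi> ?Df" and hs: "has_stem (\<lambda>q. the (f q)) (dom f) \<phi>"
    and cosp: "\<forall>\<^sub>\<approx>z\<in>D. z \<in> ?Df"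
    using stem by (auto simp: stem_on_def stem_def)
  have opf: "open ?Df"
    by (rule open_stem_dom[OF f(2)])
  have DfD: "?Df \<subseteq> D"
    by (rule stem_dom_mono[OF f(1)])
  have "\<forall>\<^sub>F m in sequentially. \<forall>u\<in>{w, cnj w}. \<forall>c\<in>bcoords. \<exists>l. ((\<lambda>z. (z - u) ^ m * c (\<phi> z)) \<longlongrightarrow> l) (at u)"
    using wD by (intro eventually_ball_finite ballI meromorphic_clear_pole meromorphic_on_subset[OF mero])
      auto
  then obtain m where m: "\<And>u c. u \<in> {w, cnj w} \<Longrightarrow> c \<in> bcoords \<Longrightarrow>
      \<exists>l. ((\<lambda>z. (z - u) ^ m * c (\<phi> z)) \<longlongrightarrow> l) (at u)"
    by (auto simp: eventually_sequentially)
  define d where "d z = (z - w) * (z - cnj w)" for z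
  define \<psi> where "\<psi> c z = d z ^ m * c (\<phi> z)" for c z
  have lim: "\<exists>l. (\<psi> c \<longlongrightarrow> l) (at u)" if u: "u \<in> {w, cnj w}" and c: "c \<in> bcoords" for u c
  proof -
    obtain l where l: "((\<lambda>z. (z - u) ^ m * c (\<phi> z)) \<longlongrightarrow> l) (at u)"
      using m[OF u c] by blast
    have "((\<lambda>z. (z - cnj u) ^ m * ((z - u) ^ m * c (\<phi> z))) \<longlongrightarrow> (u - cnj u) ^ m * l) (at u)"
      by (intro tendsto_intros l)
    moreover have "(z - cnj u) ^ m * ((z - u) ^ m * c (\<phi> z)) = \<psi> c z" for z
      using u by (auto simp: \<psi>_def d_def power_mult_distrib)
    ultimately show ?thesis
      by auto
  qed
  from cosp wD have "\<forall>\<^sub>F z in at w. z \<in> ?Df"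
    by (simp add: eventually_cosparse_open_eq[OF open_D])
  moreover have "\<forall>\<^sub>F z in at w. z \<in> D"
    using open_D wD by (rule eventually_at_in_open')
  ultimately have "\<forall>\<^sub>F z in at w. z \<in> ?Df \<and> z \<in> D"
    by (rule eventually_conj)
  then obtain r where r: "r > 0" "\<And>z. z \<noteq> w \<Longrightarrow> dist z w < r \<Longrightarrow> z \<in> ?Df"
    unfolding eventually_at by auto
  \<comment> \<open>The two discs coincide if \<open>w\<close> is real. Otherwise neither contains the centre of the other:
    without their centres they lie in the stem domain of \<open>f\<close>, which omits \<open>w\<close> and \<open>cnj w\<close>.\<close>
  define W where "W = ball w r \<union> ball (cnj w) r"
  have dist_cnj: "dist (cnj a) (cnj b) = dist a b" for a b
    by (simp add: dist_norm flip: complex_cnj_diff)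
  have W_cnj: "cnj z \<in> W" if "z \<in> W" for z
    using that dist_cnj[of w z] dist_cnj[of "cnj w" z] by (auto simp: W_def)
  have W_Df: "z \<in> ?Df" if "z \<in> W" "z \<noteq> w" "z \<noteq> cnj w" for z
  proof -
    have "dist z w < r \<or> dist (cnj z) w < r"
      using that(1) dist_cnj[of w "cnj z"] by (auto simp: W_def dist_commute)
    then show ?thesis
      using r(2)[of z] r(2)[of "cnj z"] that cnj_mem_stem_dom_iff[OF f(3)]
      by (metis complex_cnj_cnj)
  qed
  have W_D: "W \<subseteq> D"
    using W_Df DfD wD by fastforce
  have \<psi>_mero: "\<psi> c meromorphic_on D" if "c \<in> bcoords" for c
    unfolding \<psi>_def d_def using mero[OF that] by (intro meromorphic_intros)
  have \<psi>_ana: "\<psi> c analytic_on {z}" if "c \<in> bcoords" "z \<in> ?Df" for c z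
  proof -
    have "\<psi> c holomorphic_on ?Df"
      unfolding \<psi>_def d_def using holo that(1)
      by (intro holomorphic_intros) (auto simp: bholomorphic_on_def)
    then show ?thesis
      using opf that(2) by (auto simp: analytic_at)
  qed
  have rs: "remove_sings (\<psi> c) holomorphic_on W" if c: "c \<in> bcoords" for c
  proof (rule analytic_imp_holomorphic, subst analytic_on_analytic_at, intro ballI)
    fix z assume z: "z \<in> W"
    show "remove_sings (\<psi> c) analytic_on {z}"
    proof (cases "z \<in> {w, cnj w}")
      case True
      then obtain l where "(\<psi> c \<longlongrightarrow> l) (at z)"
        using lim c by blast
      moreover have "isolated_singularity_at (\<psi> c) z"
        using \<psi>_mero[OF c] z W_D by (meson meromorphic_on_isolated_singularity meromorphic_on_subset
            empty_subsetI insert_subset subsetD)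
      ultimately show ?thesis
        by (intro remove_sings_analytic_at)
    next
      case False
      then show ?thesis
        using z W_Df \<psi>_ana[OF c] by (auto intro: remove_sings_analytic_on)
    qed
  qed
  define \<xi> where "\<xi> z = Biquat (remove_sings (\<psi> b0) z) (remove_sings (\<psi> b1) z)
      (remove_sings (\<psi> b2) z) (remove_sings (\<psi> b3) z)" for z
  have \<xi>_coord: "c (\<xi> z) = remove_sings (\<psi> c) z" if "c \<in> bcoords" for c z
    using that by (auto simp: \<xi>_def)
  \<comment> \<open>Averaging with the conjugate makes the extension symmetric, and changes nothing on the
    stem domain of \<open>f\<close>, where the product is symmetric already.\<close>
  define \<xi>' where "\<xi>' z = bscalar (1 / 2) * (\<xi> z + bcnj (\<xi> (cnj z)))" for z
  have \<xi>'_sym: "stem_symmetric \<xi>'"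
    by (simp add: stem_symmetric_def \<xi>'_def biquat_eq_iff)
  have W_cnj_image: "cnj ` W = W"
    using W_cnj by (auto intro!: image_eqI[of _ cnj "cnj _"])
  have opW: "open W"
    by (simp add: W_def open_Un)
  have "bholomorphic_on \<xi>' W"
    unfolding bholomorphic_on_def
  proof
    fix c assume c: "c \<in> bcoords"
    have "cnj \<circ> remove_sings (\<psi> c) \<circ> cnj holomorphic_on W"
      using rs[OF c] by (intro holomorphic_on_compose_cnj_cnj opW) (simp add: W_cnj_image)
    then have "(\<lambda>z. 1 / 2 * (remove_sings (\<psi> c) z + (cnj \<circ> remove_sings (\<psi> c) \<circ> cnj) z)) holomorphic_on W"
      using rs[OF c] by (intro holomorphic_intros)
    moreover have "c (\<xi>' z) = 1 / 2 * (remove_sings (\<psi> c) z + (cnj \<circ> remove_sings (\<psi> c) \<circ> cnj) z)" for z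
      using c by (auto simp: \<xi>'_def \<xi>_def)
    ultimately show "(\<lambda>z. c (\<xi>' z)) holomorphic_on W"
      by (simp only:)
  qed
  define V where "V = slice_coord -` W"
  have V: "open V" "circular V" "stem_dom V = W"
    using vimage_slice_coord[OF opW W_cnj] by (auto simp: V_def)
  have \<xi>'_eq: "\<xi>' z = bscalar (d z ^ m) * \<phi> z" if z: "z \<in> ?Df" for z
  proof -
    have "\<xi> z = bscalar (d z ^ m) * \<phi> z" if z: "z \<in> ?Df" for z
    proof -
      have "remove_sings (\<psi> c) z = d z ^ m * c (\<phi> z)" if "c \<in> bcoords" for c
        using \<psi>_ana[OF that z] by (simp add: \<psi>_def)
      then show ?thesis
        by (simp add: \<xi>_def biquat_eq_iff)
    qed
    from this[of z] this[of "cnj z"] z have "\<xi> z = bscalar (d z ^ m) * \<phi> z"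
      "\<xi> (cnj z) = bscalar (d (cnj z) ^ m) * \<phi> (cnj z)"
      using cnj_mem_stem_dom_iff[OF f(3)] by auto
    moreover have "\<phi> (cnj z) = bcnj (\<phi> z)" "d (cnj z) = cnj (d z)"
      using sym by (simp_all add: stem_symmetric_def d_def)
    ultimately show ?thesis
      by (simp add: \<xi>'_def biquat_eq_iff)
  qed
  have coord_Df: "slice_coord q \<in> ?Df" if "q \<in> V - qsphere p" for q
  proof (rule W_Df)
    show "slice_coord q \<in> W"
      using that by (simp add: V_def)
    show "slice_coord q \<noteq> w"
      using that by (simp add: w_def qsphere_eq)
    then show "slice_coord q \<noteq> cnj w"
      using Im_slice_coord_ge_0[of q] Im_slice_coord_ge_0[of p]
      by (auto simp: w_def complex_eq_iff)
  qed
  show ?thesis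
    unfolding pole_or_removable_def
  proof (intro exI[of _ V] exI[of _ m] exI[of _ "induced_fun \<xi>'"] conjI ballI)
    show "open V" "circular V"
      by fact+
    show "qsphere p \<subseteq> V"
      using r(1) by (auto simp: qsphere_eq V_def W_def w_def)
    show "V \<subseteq> \<Omega>"
      using W_D slice_coord_mem_iff[OF circular_\<Omega>] by (auto simp: V_def)
    show "V - qsphere p \<subseteq> dom f"
      using coord_Df slice_coord_mem_iff[OF f(3)] by blast
    show "slice_regular_on (induced_fun \<xi>') V"
      using V \<open>bholomorphic_on \<xi>' W\<close> \<xi>'_sym
      by (intro slice_regular_on_if_stem[of _ \<xi>'] has_stem_induced_fun) simp_all
    fix q assume "q \<in> V - qsphere p"
    then have z: "slice_coord q \<in> ?Df"
      by (rule coord_Df)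
    let ?I = "slice_unit q"
    have "qdelta p q ^ m = slice_emb ?I (d (slice_coord q) ^ m)"
      using qdelta_slice_emb[of ?I p w "slice_coord q"]
      by (simp add: w_def d_def slice_emb_power)
    moreover have "the (f q) = bq_eval ?I (\<phi> (slice_coord q))"
      using hs z unfolding has_stem_def by (metis slice_emb_slice_coord slice_unit_imag_unit)
    ultimately show "induced_fun \<xi>' q = qdelta p q ^ m * the (f q)"
      by (simp add: induced_fun_def \<xi>'_eq[OF z] bq_eval_scalar_mult)
  qed
qed

lemma stem_on_imp_semireg_funs:
  assumes f: "dom f \<subseteq> \<Omega>" "open (dom f)" "circular (dom f)" and stem: "stem_on \<phi> f"
  shows "f \<in> semireg_funs \<Omega>"
  using assms stem_on_imp_pole_or_removable[OF assms] slice_regular_on_if_stem[OF f(2,3)]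
  by (auto simp: semireg_funs_def stem_on_def stem_def)

lemma semireg_funsD:
  assumes "f \<in> semireg_funs \<Omega>"
  shows "dom f \<subseteq> \<Omega>" "open (dom f)" "circular (dom f)"
  using assms by (auto simp: semireg_funs_def)

text \<open>Equality almost everywhere, with the exceptional set not accumulating in \<open>D\<close>. Poles, removable
  singularities and accidental values of \<open>\<phi>\<close> at its poles are thereby ignored.\<close>

definition agrees :: "qpfun \<Rightarrow> (complex \<Rightarrow> biquat) \<Rightarrow> bool"
  where "agrees f \<phi> \<longleftrightarrow> (\<forall>\<^sub>\<approx>z\<in>D. \<forall>I\<in>imag_units. f (slice_emb I z) = Some (bq_eval I (\<phi> z)))"

text \<open>By \<open>semireg_eq_class\<close> this is one class of \<open>semireg_eq\<close>, hence the element of the algebra that is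
  represented by the stem function \<open>\<phi>\<close>.\<close>

definition cls :: "(complex \<Rightarrow> biquat) \<Rightarrow> sem"
  where "cls \<phi> = {f \<in> semireg_funs \<Omega>. agrees f \<phi>}"

lemma stem_on_eval:
  assumes "circular (dom f)" "stem_on \<phi> f" "z \<in> stem_dom (dom f)" "I \<in> imag_units"
  shows "f (slice_emb I z) = Some (bq_eval I (\<phi> z))"
proof -
  have "slice_emb I z \<in> dom f"
    using assms by (simp add: slice_emb_mem_iff)
  with assms show ?thesis
    unfolding stem_on_def has_stem_def by (metis domD option.sel)
qed

lemma stem_on_imp_agrees:
  assumes "circular (dom f)" "stem_on \<phi> f"
  shows "agrees f \<phi>"
proof -
  have "\<forall>\<^sub>\<approx>z\<in>D. z \<in> stem_dom (dom f)"
    using assms(2) by (simp add: stem_on_def)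
  then show ?thesis
    unfolding agrees_def by eventually_elim (use stem_on_eval[OF assms] in blast)
qed

lemma agrees_unique:
  assumes "agrees f \<phi>" "agrees f \<psi>"
  shows "\<forall>\<^sub>\<approx>z\<in>D. \<phi> z = \<psi> z"
  using assms unfolding agrees_def
proof eventually_elim
  case (elim z)
  then have "bq_eval I (\<phi> z) = bq_eval I (\<psi> z)" if "I \<in> imag_units" for I
    using that by force
  then show ?case
    by (intro bq_eval_inject[of quat_i]) (simp_all add: imag_units_uminus)
qed

lemma agrees_cong: "agrees f \<phi> \<Longrightarrow> \<forall>\<^sub>\<approx>z\<in>D. \<phi> z = \<psi> z \<Longrightarrow> agrees f \<psi>"
  unfolding agrees_def by (erule (1) eventually_elim2) simp

text \<open>Rotate the set of points at which all coordinates of \<open>\<phi>\<close> are analytic. It is open, symmetric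
  and omits only a sparse set.\<close>

lemma semireg_funs_of_stem:
  assumes "stem \<phi>"
  obtains f where "f \<in> semireg_funs \<Omega>" "stem_on \<phi> f" "agrees f \<phi>"
proof -
  define A where "A = D \<inter> (\<Inter>c\<in>bcoords. {z. (\<lambda>z. c (\<phi> z)) analytic_on {z}})"
  have opA: "open A"
    unfolding A_def by (intro open_Int open_D open_INT open_analytic_points ballI) simp
  have sym: "c (\<phi> (cnj z)) = cnj (c (\<phi> z))" if "c \<in> bcoords" for c z
    using assms that by (auto simp: stem_def stem_symmetric_def)
  have A_cnj: "cnj z \<in> A" if "z \<in> A" for z
    using that sym by (auto simp: A_def intro!: analytic_at_cnj)
  define f where "f q = (if slice_coord q \<in> A then Some (induced_fun \<phi> q) else None)" for q
  have dom_f: "dom f = slice_coord -` A"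
    by (auto simp: f_def split: if_splits)
  have A: "open (dom f)" "circular (dom f)" "stem_dom (dom f) = A"
    using vimage_slice_coord[OF opA A_cnj] by (auto simp: dom_f)
  have "dom f \<subseteq> \<Omega>"
    using slice_coord_mem_iff[OF circular_\<Omega>] by (auto simp: dom_f A_def)
  have "stem_on \<phi> f"
    unfolding stem_on_def A(3)
  proof (intro conjI)
    show "stem \<phi>" by fact
    show "bholomorphic_on \<phi> A"
      unfolding bholomorphic_on_def
      by (intro ballI analytic_imp_holomorphic, subst analytic_on_analytic_at) (auto simp: A_def)
    have "the (f (slice_emb I z)) = bq_eval I (\<phi> z)" if "I \<in> imag_units" "z \<in> A" for I z
    proof -
      have "slice_emb I z \<in> dom f"
        using that A by (simp add: slice_emb_mem_iff)
      then have "the (f (slice_emb I z)) = induced_fun \<phi> (slice_emb I z)"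
        by (auto simp: f_def split: if_splits)
      then show ?thesis
        using assms that(1) by (simp add: stem_def induced_fun_slice_emb)
    qed
    then show "has_stem (\<lambda>q. the (f q)) (dom f) \<phi>"
      by (simp add: has_stem_def A(3))
    have "\<forall>\<^sub>\<approx>z\<in>D. \<forall>c\<in>bcoords. (\<lambda>z. c (\<phi> z)) analytic_on {z}"
      using assms by (intro eventually_ball_finite ballI meromorphic_on_imp_analytic_cosparse)
        (auto simp: stem_def)
    moreover have "\<forall>\<^sub>\<approx>z\<in>D. z \<in> D"
      using open_D by (intro eventually_in_cosparse) auto
    ultimately show "\<forall>\<^sub>\<approx>z\<in>D. z \<in> A"
      by eventually_elim (auto simp: A_def)
  qed
  then show ?thesis
    using A \<open>dom f \<subseteq> \<Omega>\<close> by (intro that[of f] stem_on_imp_semireg_funs stem_on_imp_agrees)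
qed

text \<open>From right to left, equality almost everywhere extends to all common points of the domains by
  continuity; for this the stems are first replaced by the ones that are holomorphic there.\<close>

lemma semireg_eq_iff:
  assumes f: "f \<in> semireg_funs \<Omega>" "agrees f \<phi>" and g: "g \<in> semireg_funs \<Omega>" "agrees g \<psi>"
  shows "(f, g) \<in> semireg_eq \<Omega> \<longleftrightarrow> (\<forall>\<^sub>\<approx>z\<in>D. \<phi> z = \<psi> z)"
proof
  assume "(f, g) \<in> semireg_eq \<Omega>"
  then have eq: "\<And>q. q \<in> dom f \<inter> dom g \<Longrightarrow> f q = g q"
    by (auto simp: semireg_eq_def)
  from f(2) g(2) have "agrees f \<psi>"
    unfolding agrees_def by eventually_elim (metis IntI domI eq)
  with f(2) show "\<forall>\<^sub>\<approx>z\<in>D. \<phi> z = \<psi> z"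
    by (rule agrees_unique)
next
  assume eq: "\<forall>\<^sub>\<approx>z\<in>D. \<phi> z = \<psi> z"
  obtain \<phi>' where \<phi>': "stem_on \<phi>' f"
    using semireg_funs_imp_stem[OF f(1)] .
  obtain \<psi>' where \<psi>': "stem_on \<psi>' g"
    using semireg_funs_imp_stem[OF g(1)] .
  have circ: "circular (dom f)" "circular (dom g)"
    using semireg_funsD f(1) g(1) by auto
  have "\<forall>\<^sub>\<approx>z\<in>D. \<phi>' z = \<phi> z" "\<forall>\<^sub>\<approx>z\<in>D. \<psi>' z = \<psi> z"
    using agrees_unique stem_on_imp_agrees circ \<phi>' \<psi>' f(2) g(2) by blast+
  with eq have eq': "\<forall>\<^sub>\<approx>z\<in>D. \<phi>' z = \<psi>' z"
    by eventually_elim simp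
  have "f q = g q" if q: "q \<in> dom f" "q \<in> dom g" for q
  proof -
    define z where "z = slice_coord q"
    have z: "z \<in> stem_dom (dom f)" "z \<in> stem_dom (dom g)"
      using q circ by (simp_all add: z_def slice_coord_mem_iff)
    have "z \<in> D"
      using z(1) stem_dom_mono[OF semireg_funsD(1)[OF f(1)]] by blast
    with eq' have ev: "\<forall>\<^sub>F w in at z. \<phi>' w = \<psi>' w"
      by (simp add: eventually_cosparse_open_eq[OF open_D])
    have "c (\<phi>' z) = c (\<psi>' z)" if c: "c \<in> bcoords" for c
    proof -
      have "open (stem_dom (dom f))" "open (stem_dom (dom g))"
        using semireg_funsD f(1) g(1) open_stem_dom by blast+
      moreover have "(\<lambda>z. c (\<phi>' z)) holomorphic_on stem_dom (dom f)"
        "(\<lambda>z. c (\<psi>' z)) holomorphic_on stem_dom (dom g)"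
        using c \<phi>' \<psi>' by (auto simp: stem_on_def bholomorphic_on_def)
      ultimately have "isCont (\<lambda>z. c (\<phi>' z)) z" "isCont (\<lambda>z. c (\<psi>' z)) z"
        using z holomorphic_on_imp_continuous_on continuous_on_eq_continuous_at by blast+
      then have "((\<lambda>z. c (\<phi>' z)) \<longlongrightarrow> c (\<phi>' z)) (at z)" "((\<lambda>z. c (\<psi>' z)) \<longlongrightarrow> c (\<psi>' z)) (at z)"
        by (simp_all add: isCont_def)
      moreover have "\<forall>\<^sub>F w in at z. c (\<phi>' w) = c (\<psi>' w)"
        using ev by eventually_elim simp
      ultimately have "((\<lambda>z. c (\<psi>' z)) \<longlongrightarrow> c (\<phi>' z)) (at z)"
        by (simp add: tendsto_cong)
      then show ?thesis
        using \<open>((\<lambda>z. c (\<psi>' z)) \<longlongrightarrow> c (\<psi>' z)) (at z)\<close> by (rule LIM_unique)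
    qed
    then have "\<phi>' z = \<psi>' z"
      by (simp add: biquat_eq_iff)
    moreover have "f (slice_emb (slice_unit q) z) = Some (bq_eval (slice_unit q) (\<phi>' z))"
      "g (slice_emb (slice_unit q) z) = Some (bq_eval (slice_unit q) (\<psi>' z))"
      using stem_on_eval circ \<phi>' \<psi>' z by simp_all
    ultimately show ?thesis
      by (simp add: z_def)
  qed
  then show "(f, g) \<in> semireg_eq \<Omega>"
    using f(1) g(1) by (auto simp: semireg_eq_def)
qed

lemma semireg_eq_class:
  assumes "f \<in> semireg_funs \<Omega>" "agrees f \<phi>"
  shows "semireg_eq \<Omega> `` {f} = cls \<phi>"
proof (intro Set.set_eqI iffI)
  fix g assume "g \<in> semireg_eq \<Omega> `` {f}"
  then have fg: "(f, g) \<in> semireg_eq \<Omega>" and g: "g \<in> semireg_funs \<Omega>"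
    by (auto simp: semireg_eq_def)
  obtain \<psi> where "stem_on \<psi> g"
    using semireg_funs_imp_stem[OF g] .
  then have \<psi>: "agrees g \<psi>"
    using stem_on_imp_agrees semireg_funsD(3)[OF g] by blast
  have "\<forall>\<^sub>\<approx>z\<in>D. \<psi> z = \<phi> z"
    using semireg_eq_iff[OF assms g \<psi>] fg by (simp add: eq_commute)
  then show "g \<in> cls \<phi>"
    using agrees_cong[OF \<psi>] g by (simp add: cls_def)
next
  fix g assume "g \<in> cls \<phi>"
  then show "g \<in> semireg_eq \<Omega> `` {f}"
    using semireg_eq_iff[OF assms, of g \<phi>] by (simp add: cls_def)
qed

lemma carrier_SEM: "carrier (SEM \<Omega>) = cls ` {\<phi>. stem \<phi>}"
proof (intro Set.set_eqI iffI)
  fix F assume "F \<in> carrier (SEM \<Omega>)"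
  then obtain f where f: "f \<in> semireg_funs \<Omega>" and F: "F = semireg_eq \<Omega> `` {f}"
    by (auto simp: SEM_def quotient_def)
  obtain \<phi> where \<phi>: "stem_on \<phi> f"
    using semireg_funs_imp_stem[OF f] .
  then have "F = cls \<phi>"
    unfolding F using semireg_eq_class[OF f] stem_on_imp_agrees semireg_funsD(3)[OF f] by blast
  then show "F \<in> cls ` {\<phi>. stem \<phi>}"
    using \<phi> by (auto simp: stem_on_def)
next
  fix F assume "F \<in> cls ` {\<phi>. stem \<phi>}"
  then obtain \<phi> where \<phi>: "stem \<phi>" "F = cls \<phi>"
    by blast
  obtain f where f: "f \<in> semireg_funs \<Omega>" "agrees f \<phi>"
    using semireg_funs_of_stem[OF \<phi>(1)] .
  show "F \<in> carrier (SEM \<Omega>)"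
    using semireg_eq_class[OF f] f(1) \<phi>(2) by (auto simp: SEM_def quotient_def)
qed

lemma cls_eq_iff:
  assumes "stem \<phi>" "stem \<psi>"
  shows "cls \<phi> = cls \<psi> \<longleftrightarrow> (\<forall>\<^sub>\<approx>z\<in>D. \<phi> z = \<psi> z)"
proof
  assume eq: "cls \<phi> = cls \<psi>"
  obtain f where "f \<in> cls \<phi>"
    using semireg_funs_of_stem[OF assms(1)] by (auto simp: cls_def)
  with eq have "agrees f \<phi>" "agrees f \<psi>"
    by (auto simp: cls_def)
  then show "\<forall>\<^sub>\<approx>z\<in>D. \<phi> z = \<psi> z"
    by (rule agrees_unique)
next
  assume eq: "\<forall>\<^sub>\<approx>z\<in>D. \<phi> z = \<psi> z"
  then have "\<forall>\<^sub>\<approx>z\<in>D. \<psi> z = \<phi> z"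
    by (simp add: eq_commute)
  with eq show "cls \<phi> = cls \<psi>"
    by (auto simp: cls_def intro: agrees_cong)
qed

lemma cls_nonempty: "stem \<phi> \<Longrightarrow> \<exists>f. f \<in> cls \<phi>"
  using semireg_funs_of_stem[of \<phi>] by (auto simp: cls_def)

lemma stem_add: "stem \<phi> \<Longrightarrow> stem \<psi> \<Longrightarrow> stem (\<lambda>z. \<phi> z + \<psi> z)"
  by (auto simp: stem_def stem_symmetric_def biquat_eq_iff intro!: meromorphic_intros)

lemma stem_mult: "stem \<phi> \<Longrightarrow> stem \<psi> \<Longrightarrow> stem (\<lambda>z. \<phi> z * \<psi> z)"
  by (auto simp: stem_def stem_symmetric_def biquat_eq_iff intro!: meromorphic_intros)

lemma stem_const: "stem (\<lambda>_. bconst a)"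
  by (auto simp: stem_def stem_symmetric_def biquat_eq_iff)

text \<open>The common part of addition and multiplication. The sum or product of two representatives is
  semi-regular because its stem function is the sum or product of theirs, which is meromorphic. Since
  all representatives thus yield the same class, the union over them is that class.\<close>

lemma pf_binary_class:
  assumes \<phi>: "stem \<phi>" and \<psi>: "stem \<psi>"
    and dom: "\<And>f g. dom (pf f g) = dom f \<inter> dom g"
    and stem: "\<And>\<phi> \<psi>. stem \<phi> \<Longrightarrow> stem \<psi> \<Longrightarrow> stem (\<lambda>z. op (\<phi> z) (\<psi> z))"
    and holo: "\<And>\<phi> \<psi> A. bholomorphic_on \<phi> A \<Longrightarrow> bholomorphic_on \<psi> A \<Longrightarrow>
      bholomorphic_on (\<lambda>z. op (\<phi> z) (\<psi> z)) A"
    and eval: "\<And>f g v w z I. I \<in> imag_units \<Longrightarrow>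
      (\<And>J. J \<in> imag_units \<Longrightarrow> f (slice_emb J z) = Some (bq_eval J v)) \<Longrightarrow>
      (\<And>J. J \<in> imag_units \<Longrightarrow> g (slice_emb J z) = Some (bq_eval J w)) \<Longrightarrow>
      pf f g (slice_emb I z) = Some (bq_eval I (op v w))"
  shows "(\<Union>f\<in>cls \<phi>. \<Union>g\<in>cls \<psi>. semireg_eq \<Omega> `` {pf f g}) = cls (\<lambda>z. op (\<phi> z) (\<psi> z))"
proof -
  have "semireg_eq \<Omega> `` {pf f g} = cls (\<lambda>z. op (\<phi> z) (\<psi> z))" if f: "f \<in> cls \<phi>" and g: "g \<in> cls \<psi>" for f g
  proof (rule semireg_eq_class)
    from f g have sr: "f \<in> semireg_funs \<Omega>" "g \<in> semireg_funs \<Omega>" and ag: "agrees f \<phi>" "agrees g \<psi>"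
      by (auto simp: cls_def)
    note fD = semireg_funsD[OF sr(1)] and gD = semireg_funsD[OF sr(2)]
    obtain \<phi>' where \<phi>': "stem_on \<phi>' f"
      using semireg_funs_imp_stem[OF sr(1)] .
    obtain \<psi>' where \<psi>': "stem_on \<psi>' g"
      using semireg_funs_imp_stem[OF sr(2)] .
    show "agrees (pf f g) (\<lambda>z. op (\<phi> z) (\<psi> z))"
      using ag unfolding agrees_def by eventually_elim (simp add: eval)
    have "stem_on (\<lambda>z. op (\<phi>' z) (\<psi>' z)) (pf f g)"
      unfolding stem_on_def dom stem_dom_Int
    proof (intro conjI)
      show "stem (\<lambda>z. op (\<phi>' z) (\<psi>' z))"
        using \<phi>' \<psi>' by (simp add: stem stem_on_def)
      show "bholomorphic_on (\<lambda>z. op (\<phi>' z) (\<psi>' z)) (stem_dom (dom f) \<inter> stem_dom (dom g))"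
        using \<phi>' \<psi>' by (intro holo) (auto simp: stem_on_def elim: bholomorphic_on_subset)
      show "has_stem (\<lambda>q. the (pf f g q)) (dom f \<inter> dom g) (\<lambda>z. op (\<phi>' z) (\<psi>' z))"
        using stem_on_eval[OF fD(3) \<phi>'] stem_on_eval[OF gD(3) \<psi>']
        by (simp add: has_stem_def stem_dom_Int eval)
      have "\<forall>\<^sub>\<approx>z\<in>D. z \<in> stem_dom (dom f)" "\<forall>\<^sub>\<approx>z\<in>D. z \<in> stem_dom (dom g)"
        using \<phi>' \<psi>' by (simp_all add: stem_on_def)
      then show "\<forall>\<^sub>\<approx>z\<in>D. z \<in> stem_dom (dom f) \<inter> stem_dom (dom g)"
        by eventually_elim simp
    qed
    then show "pf f g \<in> semireg_funs \<Omega>"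
      using fD gD by (intro stem_on_imp_semireg_funs) (auto simp: dom circular_Int)
  qed
  then show ?thesis
    using cls_nonempty[OF \<phi>] cls_nonempty[OF \<psi>] by blast
qed

lemma add_SEM:
  assumes "stem \<phi>" "stem \<psi>"
  shows "cls \<phi> \<oplus>\<^bsub>SEM \<Omega>\<^esub> cls \<psi> = cls (\<lambda>z. \<phi> z + \<psi> z)"
proof -
  have "(\<Union>f\<in>cls \<phi>. \<Union>g\<in>cls \<psi>. semireg_eq \<Omega> `` {pf_add f g}) = cls (\<lambda>z. \<phi> z + \<psi> z)"
  proof (rule pf_binary_class[OF assms _ stem_add bholomorphic_on_add])
    show "dom (pf_add f g) = dom f \<inter> dom g" for f g
      by (auto simp: pf_add_def split: if_splits)
  qed (auto simp: pf_add_def bq_eval_add)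
  then show ?thesis
    by (simp add: SEM_def sem_add_def)
qed

lemma mult_SEM:
  assumes "stem \<phi>" "stem \<psi>"
  shows "cls \<phi> \<otimes>\<^bsub>SEM \<Omega>\<^esub> cls \<psi> = cls (\<lambda>z. \<phi> z * \<psi> z)"
proof -
  have "(\<Union>f\<in>cls \<phi>. \<Union>g\<in>cls \<psi>. semireg_eq \<Omega> `` {pf_star f g}) = cls (\<lambda>z. \<phi> z * \<psi> z)"
  proof (rule pf_binary_class[OF assms _ stem_mult bholomorphic_on_mult])
    show "dom (pf_star f g) = dom f \<inter> dom g" for f g
      by (auto simp: pf_star_def split: if_splits)
  qed (auto simp: pf_star_def star_eval)
  then show ?thesis
    by (simp add: SEM_def sem_mult_def)
qed

lemma sem_const_eq: "sem_const \<Omega> a = cls (\<lambda>_. bconst a)"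
proof -
  let ?f = "\<lambda>q. if q \<in> \<Omega> then Some a else None"
  have dom: "dom ?f = \<Omega>"
    by (auto split: if_splits)
  have "stem_on (\<lambda>_. bconst a) ?f"
    unfolding stem_on_def dom
    using stem_const open_D
    by (auto simp: bholomorphic_on_def has_stem_def slice_emb_mem_iff[OF circular_\<Omega>]
        intro!: eventually_in_cosparse)
  then show ?thesis
    unfolding sem_const_def using open_\<Omega> circular_\<Omega>
    by (intro semireg_eq_class stem_on_imp_semireg_funs stem_on_imp_agrees) (simp_all add: dom)
qed

lemma one_SEM: "\<one>\<^bsub>SEM \<Omega>\<^esub> = cls (\<lambda>_. 1)"
  and zero_SEM: "\<zero>\<^bsub>SEM \<Omega>\<^esub> = cls (\<lambda>_. 0)"
proof -
  have "bconst 1 = 1" "bconst 0 = 0"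
    by (simp_all add: biquat_eq_iff)
  then show "\<one>\<^bsub>SEM \<Omega>\<^esub> = cls (\<lambda>_. 1)" "\<zero>\<^bsub>SEM \<Omega>\<^esub> = cls (\<lambda>_. 0)"
    by (simp_all add: SEM_def sem_const_eq)
qed

section \<open>Scalars and the identity theorem\<close>

text \<open>The stems of slice preserving functions, see \<open>carrier_SEM_R\<close>.\<close>

definition real_meromorphic :: "(complex \<Rightarrow> complex) \<Rightarrow> bool"
  where "real_meromorphic \<alpha> \<longleftrightarrow> \<alpha> meromorphic_on D \<and> (\<forall>z. \<alpha> (cnj z) = cnj (\<alpha> z))"

lemma stem_iff: "stem \<phi> \<longleftrightarrow> (\<forall>c\<in>bcoords. real_meromorphic (\<lambda>z. c (\<phi> z)))"
  by (auto simp: stem_def stem_symmetric_def real_meromorphic_def biquat_eq_iff)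

lemma stem_bscalar: "real_meromorphic \<alpha> \<Longrightarrow> stem (\<lambda>z. bscalar (\<alpha> z))"
  by (simp add: stem_iff) (simp add: real_meromorphic_def meromorphic_on_const)

lemma real_meromorphic_inverse: "real_meromorphic \<alpha> \<Longrightarrow> real_meromorphic (\<lambda>z. inverse (\<alpha> z))"
  by (simp add: real_meromorphic_def meromorphic_on_inverse)

lemma stem_bconj: "stem \<phi> \<Longrightarrow> stem (\<lambda>z. bconj (\<phi> z))"
  by (simp add: stem_iff) (simp add: real_meromorphic_def meromorphic_on_uminus)

lemma stem_uminus: "stem \<phi> \<Longrightarrow> stem (\<lambda>z. - \<phi> z)"
  by (simp add: stem_iff) (simp add: real_meromorphic_def meromorphic_on_uminus)

lemma stem_0: "stem (\<lambda>_. 0)" and stem_1: "stem (\<lambda>_. 1)"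
  by (simp_all add: stem_iff real_meromorphic_def meromorphic_on_const)

lemma real_meromorphic_bnorm:
  assumes "stem \<phi>"
  shows "real_meromorphic (\<lambda>z. bnorm (\<phi> z))"
  using assms unfolding stem_iff real_meromorphic_def bnorm_def
  by (auto intro!: meromorphic_intros)

text \<open>The upper half of \<open>D\<close> is the continuous image of the connected set \<open>\<Omega>\<close>, although \<open>D\<close> itself
  is disconnected when \<open>\<Omega>\<close> is nonempty without real points. The identity theorem on it and the symmetry of
  \<open>\<alpha>\<close> under conjugation give it on all of \<open>D\<close>.\<close>

lemma real_meromorphic_zero_or_nonzero:
  assumes "real_meromorphic \<alpha>"
  shows "(\<forall>\<^sub>\<approx>z\<in>D. \<alpha> z = 0) \<or> (\<forall>\<^sub>\<approx>z\<in>D. \<alpha> z \<noteq> 0)"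
proof -
  define H where "H = {z \<in> D. Im z \<ge> 0}"
  have "H = slice_coord ` \<Omega>"
  proof (intro Set.set_eqI iffI)
    fix z assume "z \<in> H"
    then show "z \<in> slice_coord ` \<Omega>"
      by (intro image_eqI[of _ _ "slice_emb quat_i z"])
        (auto simp: H_def stem_dom_def slice_coord_slice_emb complex_eq_iff)
  next
    fix z assume "z \<in> slice_coord ` \<Omega>"
    then show "z \<in> H"
      using slice_coord_mem_iff[OF circular_\<Omega>] Im_slice_coord_ge_0 by (auto simp: H_def)
  qed
  moreover have "connected \<Omega>"
    using circular_domain by (simp add: circular_domain_def)
  ultimately have conn: "connected H"
    using continuous_on_slice_coord by (simp add: connected_continuous_image)
  \<comment> \<open>\<open>E\<close> is used for \<open>\<alpha> = 0\<close> and \<open>\<alpha> \<noteq> 0\<close>: two disjoint open sets which cover \<open>D\<close>, because a meromorphic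
    function near a point is either zero or without zeros in a punctured disc.\<close>
  define E where "E P = {z. \<forall>\<^sub>F w in at z. P (\<alpha> w)}" for P
  have openE: "open (E P)" for P
  proof (subst open_subopen, intro ballI)
    fix z assume "z \<in> E P"
    then obtain S where S: "open S" "z \<in> S" "\<And>w. w \<in> S \<Longrightarrow> w \<noteq> z \<Longrightarrow> P (\<alpha> w)"
      by (auto simp: E_def eventually_at_topological)
    have "u \<in> E P" if "u \<in> S" for u
    proof -
      have "\<forall>\<^sub>F w in at u. w \<in> S \<and> w \<noteq> z"
        using S(1) that by (intro eventually_conj eventually_at_in_open' eventually_neq_at_within)
      then show ?thesis
        unfolding E_def mem_Collect_eq by eventually_elim (use S(3) in blast)
    qed
    with S show "\<exists>T. open T \<and> z \<in> T \<and> T \<subseteq> E P"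
      by blast
  qed
  have "z \<in> E (\<lambda>x. x = 0) \<or> z \<in> E (\<lambda>x. x \<noteq> 0)" if "z \<in> D" for z
  proof -
    have "\<alpha> meromorphic_on {z}"
      using assms that by (auto simp: real_meromorphic_def elim: meromorphic_on_subset)
    then have "\<forall>\<^sub>F w in at z. \<alpha> w \<noteq> 0" if "\<exists>\<^sub>F w in at z. \<alpha> w \<noteq> 0"
      using that by (auto simp: meromorphic_at_iff intro: non_zero_neighbour)
    then show ?thesis
      by (auto simp: E_def frequently_def)
  qed
  then have "H \<subseteq> E (\<lambda>x. x = 0) \<union> E (\<lambda>x. x \<noteq> 0)"
    by (auto simp: H_def)
  moreover have "E (\<lambda>x. x = 0) \<inter> E (\<lambda>x. x \<noteq> 0) = {}"
  proof -
    have False if "\<forall>\<^sub>F w in at z. \<alpha> w = 0" "\<forall>\<^sub>F w in at z. \<alpha> w \<noteq> 0" for z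
    proof -
      from that have "\<forall>\<^sub>F w in at z. False"
        by eventually_elim simp
      then show False
        by (simp add: trivial_limit_at eventually_False)
    qed
    then show ?thesis
      by (auto simp: E_def)
  qed
  ultimately have "E (\<lambda>x. x = 0) \<inter> H = {} \<or> E (\<lambda>x. x \<noteq> 0) \<inter> H = {}"
    using connectedD[OF conn openE openE] by blast
  with \<open>H \<subseteq> _\<close> have H: "H \<subseteq> E (\<lambda>x. x = 0) \<or> H \<subseteq> E (\<lambda>x. x \<noteq> 0)"
    by blast
  have cnj_E: "cnj z \<in> E P" if z: "z \<in> E P" and P: "\<And>w. P (cnj w) = P w" for P z
  proof -
    from z have "\<exists>d>0. \<forall>w. w \<noteq> z \<and> dist w z < d \<longrightarrow> P (\<alpha> w)"
      by (simp add: E_def eventually_at)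
    then obtain d where d: "d > 0" "\<And>w. w \<noteq> z \<Longrightarrow> dist w z < d \<Longrightarrow> P (\<alpha> w)"
      by metis
    have "P (\<alpha> w)" if w: "w \<noteq> cnj z" "dist w (cnj z) < d" for w
    proof -
      have "dist (cnj w) z = dist w (cnj z)"
        by (metis complex_cnj_cnj complex_cnj_diff complex_mod_cnj dist_norm)
      moreover have "cnj w \<noteq> z"
        using w(1) by auto
      ultimately have "P (\<alpha> (cnj w))"
        using w(2) d(2) by simp
      then show ?thesis
        using assms P by (simp add: real_meromorphic_def)
    qed
    then show ?thesis
      using d(1) by (auto simp: E_def eventually_at)
  qed
  have all: "\<forall>\<^sub>\<approx>z\<in>D. P (\<alpha> z)" if "H \<subseteq> E P" "\<And>w. P (cnj w) = P w" for P
  proof -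
    have "z \<in> E P" if z: "z \<in> D" for z
    proof (cases "Im z \<ge> 0")
      case True
      then show ?thesis
        using \<open>H \<subseteq> E P\<close> z by (auto simp: H_def)
    next
      case False
      then have "cnj z \<in> E P"
        using \<open>H \<subseteq> E P\<close> z by (auto simp: H_def)
      then show ?thesis
        using cnj_E[of "cnj z" P] \<open>\<And>w. P (cnj w) = P w\<close> by simp
    qed
    then show ?thesis
      by (auto simp: eventually_cosparse_open_eq[OF open_D] E_def)
  qed
  from H show ?thesis
    using all[of "\<lambda>x. x = 0"] all[of "\<lambda>x. x \<noteq> 0"] by auto
qed

lemma cls_carrier [simp]: "stem \<phi> \<Longrightarrow> cls \<phi> \<in> carrier (SEM \<Omega>)"
  by (simp add: carrier_SEM)

lemma SEM_cases:
  assumes "F \<in> carrier (SEM \<Omega>)"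
  obtains \<phi> where "stem \<phi>" "F = cls \<phi>"
  using assms by (auto simp: carrier_SEM)

lemma cls_eqI:
  assumes "stem \<phi>" "stem \<psi>" "\<forall>\<^sub>\<approx>z\<in>D. \<phi> z = \<psi> z"
  shows "cls \<phi> = cls \<psi>"
  using assms by (simp add: cls_eq_iff)

lemma monoid_SEM: "monoid (SEM \<Omega>)"
proof
  fix x y z
  assume "x \<in> carrier (SEM \<Omega>)" "y \<in> carrier (SEM \<Omega>)" "z \<in> carrier (SEM \<Omega>)"
  then obtain \<phi> \<psi> \<xi> where "stem \<phi>" "x = cls \<phi>" "stem \<psi>" "y = cls \<psi>" "stem \<xi>" "z = cls \<xi>"
    by (metis SEM_cases)
  then show "x \<otimes>\<^bsub>SEM \<Omega>\<^esub> y \<otimes>\<^bsub>SEM \<Omega>\<^esub> z = x \<otimes>\<^bsub>SEM \<Omega>\<^esub> (y \<otimes>\<^bsub>SEM \<Omega>\<^esub> z)"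
    by (simp add: mult_SEM stem_mult mult.assoc)
qed (auto simp: one_SEM carrier_SEM mult_SEM stem_mult stem_1)

lemma uminus_SEM:
  assumes "stem \<phi>"
  shows "\<ominus>\<^bsub>SEM \<Omega>\<^esub> cls \<phi> = cls (\<lambda>z. - \<phi> z)"
  unfolding a_inv_def m_inv_def
proof (rule the_equality)
  fix y assume y: "y \<in> carrier (add_monoid (SEM \<Omega>)) \<and>
    cls \<phi> \<otimes>\<^bsub>add_monoid (SEM \<Omega>)\<^esub> y = \<one>\<^bsub>add_monoid (SEM \<Omega>)\<^esub> \<and>
    y \<otimes>\<^bsub>add_monoid (SEM \<Omega>)\<^esub> cls \<phi> = \<one>\<^bsub>add_monoid (SEM \<Omega>)\<^esub>"
  then obtain \<psi> where \<psi>: "stem \<psi>" "y = cls \<psi>"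
    by (auto elim: SEM_cases)
  with y assms have "\<forall>\<^sub>\<approx>z\<in>D. \<phi> z + \<psi> z = 0"
    by (simp add: add_SEM zero_SEM cls_eq_iff stem_add stem_0)
  then have "\<forall>\<^sub>\<approx>z\<in>D. \<psi> z = - \<phi> z"
    by eventually_elim (simp add: eq_neg_iff_add_eq_0 add.commute)
  then show "y = cls (\<lambda>z. - \<phi> z)"
    using \<psi> assms by (simp add: cls_eq_iff stem_uminus)
qed (use assms in \<open>simp add: add_SEM zero_SEM stem_uminus\<close>)

text \<open>A value in \<open>\<complex>\<^sub>I\<close> for every \<open>I\<close> forces the stem to be scalar; the units \<open>\<plusminus> i\<close> and \<open>\<plusminus> j\<close> suffice for this.
  Conversely, a scalar stem has a representative that is computed by it everywhere on its domain, and
  not only almost everywhere, so that this representative is slice preserving.\<close>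

lemma carrier_SEM_R: "carrier (SEM_R \<Omega>) = (\<lambda>\<alpha>. cls (\<lambda>z. bscalar (\<alpha> z))) ` {\<alpha>. real_meromorphic \<alpha>}"
proof (intro Set.set_eqI iffI)
  fix F assume "F \<in> carrier (SEM_R \<Omega>)"
  then obtain f where F: "F \<in> carrier (SEM \<Omega>)" and f: "f \<in> F" "slice_preserving f"
    by (auto simp: SEM_R_def)
  obtain \<phi> where \<phi>: "stem \<phi>" "F = cls \<phi>"
    using SEM_cases[OF F] .
  with f have "agrees f \<phi>"
    by (simp add: cls_def)
  then have "\<forall>\<^sub>\<approx>z\<in>D. \<phi> z = bscalar (b0 (\<phi> z))"
    unfolding agrees_def
  proof eventually_elim
    case (elim z)
    have mem: "bq_eval I (\<phi> z) \<in> slice_plane I" if I: "I \<in> imag_units" for I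
    proof -
      have "slice_emb I z \<in> dom f \<inter> slice_plane I"
        using elim I by (auto simp: slice_plane_def slice_emb_def)
      then have "the (f (slice_emb I z)) \<in> slice_plane I"
        using f(2) I unfolding slice_preserving_def by blast
      then show ?thesis
        using elim I by simp
    qed
    have "b2 (\<phi> z) = 0 \<and> b3 (\<phi> z) = 0"
      using mem[of quat_i] mem[of "- quat_i"]
      by (auto simp: imag_units_uminus slice_plane_def slice_pt_eq_slice_emb bq_eval_eq quat_eq_iff
          complex_eq_iff)
    moreover have "b1 (\<phi> z) = 0 \<and> b3 (\<phi> z) = 0"
      using mem[of quat_j] mem[of "- quat_j"]
      by (auto simp: imag_units_uminus slice_plane_def slice_pt_eq_slice_emb bq_eval_eq quat_eq_iff
          complex_eq_iff)
    ultimately show ?case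
      by (simp add: biquat_eq_iff)
  qed
  moreover have re: "real_meromorphic (\<lambda>z. b0 (\<phi> z))"
    using \<phi>(1) by (simp add: stem_iff)
  ultimately have "F = cls (\<lambda>z. bscalar (b0 (\<phi> z)))"
    unfolding \<phi>(2) using \<phi>(1) by (intro cls_eqI stem_bscalar)
  with re show "F \<in> (\<lambda>\<alpha>. cls (\<lambda>z. bscalar (\<alpha> z))) ` {\<alpha>. real_meromorphic \<alpha>}"
    by (intro image_eqI[where x = "\<lambda>z. b0 (\<phi> z)"]) simp_all
next
  fix F assume "F \<in> (\<lambda>\<alpha>. cls (\<lambda>z. bscalar (\<alpha> z))) ` {\<alpha>. real_meromorphic \<alpha>}"
  then obtain \<alpha> where \<alpha>: "real_meromorphic \<alpha>" "F = cls (\<lambda>z. bscalar (\<alpha> z))"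
    by blast
  obtain f where f: "f \<in> semireg_funs \<Omega>" "stem_on (\<lambda>z. bscalar (\<alpha> z)) f" "agrees f (\<lambda>z. bscalar (\<alpha> z))"
    using semireg_funs_of_stem[OF stem_bscalar[OF \<alpha>(1)]] .
  have circ: "circular (dom f)"
    by (rule semireg_funsD(3)[OF f(1)])
  have "slice_preserving f"
    unfolding slice_preserving_def
  proof (intro ballI subsetI)
    fix I p assume I: "I \<in> imag_units" and "p \<in> (\<lambda>q. the (f q)) ` (dom f \<inter> slice_plane I)"
    then obtain z where "slice_emb I z \<in> dom f" "p = the (f (slice_emb I z))"
      by (auto simp: slice_plane_def slice_pt_eq_slice_emb)
    then have "p = slice_emb I (\<alpha> z)"
      using stem_on_eval[OF circ f(2) _ I] by (simp add: slice_emb_mem_iff[OF circ I])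
    then show "p \<in> slice_plane I"
      by (auto simp: slice_plane_def slice_emb_def)
  qed
  moreover have "f \<in> F"
    using f(1,3) \<alpha>(2) by (simp add: cls_def)
  ultimately show "F \<in> carrier (SEM_R \<Omega>)"
    using \<alpha> by (auto simp: SEM_R_def stem_bscalar)
qed

lemma SEM_R_ops [simp]: "x \<otimes>\<^bsub>SEM_R \<Omega>\<^esub> y = x \<otimes>\<^bsub>SEM \<Omega>\<^esub> y" "\<one>\<^bsub>SEM_R \<Omega>\<^esub> = \<one>\<^bsub>SEM \<Omega>\<^esub>"
  by (simp_all add: SEM_R_def)

lemma inv_SEM_R:
  assumes \<alpha>: "real_meromorphic \<alpha>" and nz: "\<forall>\<^sub>\<approx>z\<in>D. \<alpha> z \<noteq> 0"
  shows "inv\<^bsub>SEM_R \<Omega>\<^esub> cls (\<lambda>z. bscalar (\<alpha> z)) = cls (\<lambda>z. bscalar (inverse (\<alpha> z)))"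
  unfolding m_inv_def SEM_R_ops
proof (rule the_equality)
  have "\<forall>\<^sub>\<approx>z\<in>D. bscalar (\<alpha> z) * bscalar (inverse (\<alpha> z)) = 1 \<and> bscalar (inverse (\<alpha> z)) * bscalar (\<alpha> z) = 1"
    using nz by eventually_elim (simp add: biquat_eq_iff)
  then show "cls (\<lambda>z. bscalar (inverse (\<alpha> z))) \<in> carrier (SEM_R \<Omega>) \<and>
    cls (\<lambda>z. bscalar (\<alpha> z)) \<otimes>\<^bsub>SEM \<Omega>\<^esub> cls (\<lambda>z. bscalar (inverse (\<alpha> z))) = \<one>\<^bsub>SEM \<Omega>\<^esub> \<and>
    cls (\<lambda>z. bscalar (inverse (\<alpha> z))) \<otimes>\<^bsub>SEM \<Omega>\<^esub> cls (\<lambda>z. bscalar (\<alpha> z)) = \<one>\<^bsub>SEM \<Omega>\<^esub>"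
    using \<alpha> real_meromorphic_inverse[OF \<alpha>]
    by (auto simp: carrier_SEM_R mult_SEM one_SEM cls_eq_iff stem_mult stem_bscalar stem_1
        eventually_conj_iff)
next
  fix y assume y: "y \<in> carrier (SEM_R \<Omega>) \<and> cls (\<lambda>z. bscalar (\<alpha> z)) \<otimes>\<^bsub>SEM \<Omega>\<^esub> y = \<one>\<^bsub>SEM \<Omega>\<^esub> \<and>
    y \<otimes>\<^bsub>SEM \<Omega>\<^esub> cls (\<lambda>z. bscalar (\<alpha> z)) = \<one>\<^bsub>SEM \<Omega>\<^esub>"
  then obtain \<beta> where \<beta>: "real_meromorphic \<beta>" "y = cls (\<lambda>z. bscalar (\<beta> z))"
    by (auto simp: carrier_SEM_R)
  with y \<alpha> have "\<forall>\<^sub>\<approx>z\<in>D. bscalar (\<alpha> z) * bscalar (\<beta> z) = 1"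
    by (simp add: mult_SEM one_SEM cls_eq_iff stem_mult stem_bscalar stem_1)
  then have "\<forall>\<^sub>\<approx>z\<in>D. bscalar (\<beta> z) = bscalar (inverse (\<alpha> z))"
    using nz by eventually_elim (simp add: biquat_eq_iff inverse_unique)
  then show "y = cls (\<lambda>z. bscalar (inverse (\<alpha> z)))"
    using \<beta> \<alpha> by (simp add: cls_eq_iff stem_bscalar real_meromorphic_inverse)
qed

section \<open>Real part, conjugation and symmetrization\<close>

lemma sem_vec_cls:
  assumes "real_meromorphic \<alpha>" "real_meromorphic \<beta>" "real_meromorphic \<gamma>"
  shows "sem_vec \<Omega> (cls (\<lambda>z. bscalar (\<alpha> z))) (cls (\<lambda>z. bscalar (\<beta> z))) (cls (\<lambda>z. bscalar (\<gamma> z)))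
    = cls (\<lambda>z. Biquat 0 (\<alpha> z) (\<beta> z) (\<gamma> z))"
proof -
  have "bscalar a * bconst quat_i + bscalar b * bconst quat_j + bscalar c * bconst quat_k
      = Biquat 0 a b c" for a b c
    by (simp add: biquat_eq_iff)
  then show ?thesis
    using assms
    by (simp add: sem_vec_def sem_const_eq mult_SEM add_SEM stem_mult stem_add stem_bscalar stem_const)
qed

lemma stem_Biquat:
  assumes "real_meromorphic \<alpha>" "real_meromorphic \<beta>" "real_meromorphic \<gamma>" "real_meromorphic \<delta>"
  shows "stem (\<lambda>z. Biquat (\<alpha> z) (\<beta> z) (\<gamma> z) (\<delta> z))"
  using assms by (simp add: stem_iff)

lemma real_meromorphic_0: "real_meromorphic (\<lambda>_. 0)"
  by (simp add: real_meromorphic_def meromorphic_on_const)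

text \<open>The components of a semi-regular function are the coordinates of its stem. This determines them
  uniquely, so that the definite descriptions in \<open>sem_re\<close> and \<open>sem_conj\<close> denote.\<close>

lemma sem_components_cls_iff:
  assumes \<phi>: "stem \<phi>"
  shows "sem_components \<Omega> (cls \<phi>) F0 F1 F2 F3 \<longleftrightarrow>
    F0 = cls (\<lambda>z. bscalar (b0 (\<phi> z))) \<and> F1 = cls (\<lambda>z. bscalar (b1 (\<phi> z))) \<and>
    F2 = cls (\<lambda>z. bscalar (b2 (\<phi> z))) \<and> F3 = cls (\<lambda>z. bscalar (b3 (\<phi> z)))"
proof -
  have sum: "cls (\<lambda>z. bscalar (\<alpha> z)) \<oplus>\<^bsub>SEM \<Omega>\<^esub> sem_vec \<Omega> (cls (\<lambda>z. bscalar (\<beta> z)))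
      (cls (\<lambda>z. bscalar (\<gamma> z))) (cls (\<lambda>z. bscalar (\<delta> z))) = cls (\<lambda>z. Biquat (\<alpha> z) (\<beta> z) (\<gamma> z) (\<delta> z))"
    if "real_meromorphic \<alpha>" "real_meromorphic \<beta>" "real_meromorphic \<gamma>" "real_meromorphic \<delta>"
    for \<alpha> \<beta> \<gamma> \<delta>
  proof -
    have "bscalar a + Biquat 0 b c d = Biquat a b c d" for a b c d
      by (simp add: biquat_eq_iff)
    with that show ?thesis
      by (simp add: sem_vec_cls add_SEM stem_bscalar stem_Biquat real_meromorphic_0)
  qed
  have coords: "real_meromorphic (\<lambda>z. b0 (\<phi> z))" "real_meromorphic (\<lambda>z. b1 (\<phi> z))"
    "real_meromorphic (\<lambda>z. b2 (\<phi> z))" "real_meromorphic (\<lambda>z. b3 (\<phi> z))"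
    using \<phi> by (simp_all add: stem_iff)
  show ?thesis
  proof
    assume comp: "sem_components \<Omega> (cls \<phi>) F0 F1 F2 F3"
    then have "{F0, F1, F2, F3} \<subseteq> carrier (SEM_R \<Omega>)"
      by (simp add: sem_components_def)
    then obtain \<alpha> \<beta> \<gamma> \<delta> where r: "real_meromorphic \<alpha>" "real_meromorphic \<beta>" "real_meromorphic \<gamma>"
      "real_meromorphic \<delta>" and F: "F0 = cls (\<lambda>z. bscalar (\<alpha> z))" "F1 = cls (\<lambda>z. bscalar (\<beta> z))"
      "F2 = cls (\<lambda>z. bscalar (\<gamma> z))" "F3 = cls (\<lambda>z. bscalar (\<delta> z))"
      by (auto simp: carrier_SEM_R)
    have "cls \<phi> = cls (\<lambda>z. Biquat (\<alpha> z) (\<beta> z) (\<gamma> z) (\<delta> z))"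
      using comp sum[OF r] by (simp add: sem_components_def F)
    then have eq: "\<forall>\<^sub>\<approx>z\<in>D. \<phi> z = Biquat (\<alpha> z) (\<beta> z) (\<gamma> z) (\<delta> z)"
      using \<phi> r by (simp add: cls_eq_iff stem_Biquat)
    have "\<forall>\<^sub>\<approx>z\<in>D. bscalar (\<alpha> z) = bscalar (b0 (\<phi> z))" "\<forall>\<^sub>\<approx>z\<in>D. bscalar (\<beta> z) = bscalar (b1 (\<phi> z))"
      "\<forall>\<^sub>\<approx>z\<in>D. bscalar (\<gamma> z) = bscalar (b2 (\<phi> z))" "\<forall>\<^sub>\<approx>z\<in>D. bscalar (\<delta> z) = bscalar (b3 (\<phi> z))"
      using eq by (eventually_elim, simp)+
    then show "F0 = cls (\<lambda>z. bscalar (b0 (\<phi> z))) \<and> F1 = cls (\<lambda>z. bscalar (b1 (\<phi> z))) \<and>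
      F2 = cls (\<lambda>z. bscalar (b2 (\<phi> z))) \<and> F3 = cls (\<lambda>z. bscalar (b3 (\<phi> z)))"
      unfolding F using r coords by (intro conjI cls_eqI stem_bscalar)
  next
    assume F: "F0 = cls (\<lambda>z. bscalar (b0 (\<phi> z))) \<and> F1 = cls (\<lambda>z. bscalar (b1 (\<phi> z))) \<and>
      F2 = cls (\<lambda>z. bscalar (b2 (\<phi> z))) \<and> F3 = cls (\<lambda>z. bscalar (b3 (\<phi> z)))"
    then show "sem_components \<Omega> (cls \<phi>) F0 F1 F2 F3"
      using sum[OF coords] coords by (auto simp: sem_components_def carrier_SEM_R)
  qed
qed

lemma sem_re_cls: "stem \<phi> \<Longrightarrow> sem_re \<Omega> (cls \<phi>) = cls (\<lambda>z. bscalar (b0 (\<phi> z)))"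
  by (simp add: sem_re_def sem_components_cls_iff)

lemma sem_conj_cls:
  assumes "stem \<phi>"
  shows "sem_conj \<Omega> (cls \<phi>) = cls (\<lambda>z. bconj (\<phi> z))"
proof -
  have coords: "real_meromorphic (\<lambda>z. b0 (\<phi> z))" "real_meromorphic (\<lambda>z. b1 (\<phi> z))"
    "real_meromorphic (\<lambda>z. b2 (\<phi> z))" "real_meromorphic (\<lambda>z. b3 (\<phi> z))"
    using assms by (simp_all add: stem_iff)
  have "bscalar (b0 w) + - Biquat 0 (b1 w) (b2 w) (b3 w) = bconj w" for w
    by (simp add: biquat_eq_iff)
  with coords show ?thesis
    by (simp add: sem_conj_def sem_components_cls_iff[OF assms] sem_vec_cls a_minus_def uminus_SEM
        add_SEM stem_uminus stem_Biquat stem_bscalar real_meromorphic_0)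
qed

lemma sem_symm_cls:
  assumes "stem \<phi>"
  shows "sem_symm \<Omega> (cls \<phi>) = cls (\<lambda>z. bscalar (bnorm (\<phi> z)))"
  using assms by (simp add: sem_symm_def sem_conj_cls mult_SEM stem_bconj mult_bconj)

lemma sem_zero_divisor_cls_iff:
  assumes "stem \<phi>" "cls \<phi> \<noteq> \<zero>\<^bsub>SEM \<Omega>\<^esub>"
  shows "sem_zero_divisor \<Omega> (cls \<phi>) \<longleftrightarrow> (\<forall>\<^sub>\<approx>z\<in>D. bnorm (\<phi> z) = 0)"
  using assms
  by (simp add: sem_zero_divisor_def sem_symm_cls)
    (simp add: zero_SEM cls_eq_iff stem_bscalar real_meromorphic_bnorm stem_0 biquat_eq_iff)

text \<open>A real part that is not zero in the algebra is nonzero almost everywhere, so the inverse in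
  \<open>sem_sigma\<close> and \<open>sem_rho\<close> is the pointwise one.\<close>

lemma scaled_re_cls:
  assumes \<phi>: "stem \<phi>" and nz: "sem_re \<Omega> (cls \<phi> \<otimes>\<^bsub>SEM \<Omega>\<^esub> sem_const \<Omega> a) \<noteq> \<zero>\<^bsub>SEM \<Omega>\<^esub>"
  shows "\<forall>\<^sub>\<approx>z\<in>D. b0 (\<phi> z * bconst a) \<noteq> 0"
    and "real_meromorphic (\<lambda>z. inverse (2 * b0 (\<phi> z * bconst a)))"
    and "inv\<^bsub>SEM_R \<Omega>\<^esub> (sem_const \<Omega> 2 \<otimes>\<^bsub>SEM \<Omega>\<^esub> sem_re \<Omega> (cls \<phi> \<otimes>\<^bsub>SEM \<Omega>\<^esub> sem_const \<Omega> a))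
      = cls (\<lambda>z. bscalar (inverse (2 * b0 (\<phi> z * bconst a))))"
proof -
  define \<alpha> where "\<alpha> z = b0 (\<phi> z * bconst a)" for z
  have st: "stem (\<lambda>z. \<phi> z * bconst a)"
    by (intro stem_mult \<phi> stem_const)
  then have \<alpha>: "real_meromorphic \<alpha>"
    by (simp add: stem_iff \<alpha>_def[abs_def])
  have re: "sem_re \<Omega> (cls \<phi> \<otimes>\<^bsub>SEM \<Omega>\<^esub> sem_const \<Omega> a) = cls (\<lambda>z. bscalar (\<alpha> z))"
    using \<phi> st by (simp only: sem_const_eq mult_SEM stem_const sem_re_cls \<alpha>_def)
  have "\<not> (\<forall>\<^sub>\<approx>z\<in>D. \<alpha> z = 0)"
  proof
    assume "\<forall>\<^sub>\<approx>z\<in>D. \<alpha> z = 0"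
    then have "\<forall>\<^sub>\<approx>z\<in>D. bscalar (\<alpha> z) = 0"
      by eventually_elim (simp add: biquat_eq_iff)
    with nz \<alpha> show False
      by (simp add: re zero_SEM cls_eq_iff stem_bscalar stem_0)
  qed
  then have nz': "\<forall>\<^sub>\<approx>z\<in>D. \<alpha> z \<noteq> 0"
    using real_meromorphic_zero_or_nonzero[OF \<alpha>] by blast
  then show "\<forall>\<^sub>\<approx>z\<in>D. b0 (\<phi> z * bconst a) \<noteq> 0"
    by (simp add: \<alpha>_def)
  have 2: "real_meromorphic (\<lambda>z. 2 * \<alpha> z)"
    using \<alpha> by (auto simp: real_meromorphic_def intro!: meromorphic_intros)
  then show "real_meromorphic (\<lambda>z. inverse (2 * b0 (\<phi> z * bconst a)))"
    using real_meromorphic_inverse[OF 2] by (simp add: \<alpha>_def)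
  have "(2 :: quat) = 1 + 1"
    by simp
  then have "qRe 2 = 2" "qI 2 = 0" "qJ 2 = 0" "qK 2 = 0"
    by (simp_all only: quat_sel)
  then have "bconst 2 * bscalar c = bscalar (2 * c)" for c
    by (simp add: biquat_eq_iff)
  then have "sem_const \<Omega> 2 \<otimes>\<^bsub>SEM \<Omega>\<^esub> sem_re \<Omega> (cls \<phi> \<otimes>\<^bsub>SEM \<Omega>\<^esub> sem_const \<Omega> a) = cls (\<lambda>z. bscalar (2 * \<alpha> z))"
    unfolding re using \<alpha> by (simp add: sem_const_eq mult_SEM stem_const stem_bscalar)
  moreover have "\<forall>\<^sub>\<approx>z\<in>D. 2 * \<alpha> z \<noteq> 0"
    using nz' by eventually_elim simp
  ultimately show "inv\<^bsub>SEM_R \<Omega>\<^esub> (sem_const \<Omega> 2 \<otimes>\<^bsub>SEM \<Omega>\<^esub> sem_re \<Omega> (cls \<phi> \<otimes>\<^bsub>SEM \<Omega>\<^esub> sem_const \<Omega> a))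
      = cls (\<lambda>z. bscalar (inverse (2 * b0 (\<phi> z * bconst a))))"
    using inv_SEM_R[OF 2] by (simp add: \<alpha>_def)
qed

lemma sem_sigma_cls:
  assumes "stem \<phi>" "sem_re \<Omega> (cls \<phi> \<otimes>\<^bsub>SEM \<Omega>\<^esub> sem_const \<Omega> a) \<noteq> \<zero>\<^bsub>SEM \<Omega>\<^esub>"
  shows "sem_sigma \<Omega> (cls \<phi>) a
    = cls (\<lambda>z. bscalar (inverse (2 * b0 (\<phi> z * bconst a))) * (\<phi> z * bconst a))"
  using assms(1) scaled_re_cls(2)[OF assms]
  unfolding sem_sigma_def scaled_re_cls(3)[OF assms]
  by (simp only: sem_const_eq mult_SEM stem_bscalar stem_mult stem_const)

lemma sem_rho_cls:
  assumes "stem \<phi>" "sem_re \<Omega> (cls \<phi> \<otimes>\<^bsub>SEM \<Omega>\<^esub> sem_const \<Omega> a) \<noteq> \<zero>\<^bsub>SEM \<Omega>\<^esub>"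
  shows "sem_rho \<Omega> (cls \<phi>) a
    = cls (\<lambda>z. bscalar (inverse (2 * b0 (\<phi> z * bconst a))) * (bconst a * \<phi> z))"
  using assms(1) scaled_re_cls(2)[OF assms]
  unfolding sem_rho_def scaled_re_cls(3)[OF assms]
  by (simp only: sem_const_eq mult_SEM stem_bscalar stem_mult stem_const)

text \<open>The inverse of \<open>f\<close> is \<open>(f\<^sup>s)\<^sup>-\<^sup>1 f\<^sup>c\<close>.\<close>

lemma non_zero_divisor_inverse:
  assumes \<phi>: "stem \<phi>" and "cls \<phi> \<noteq> \<zero>\<^bsub>SEM \<Omega>\<^esub>" "\<not> sem_zero_divisor \<Omega> (cls \<phi>)"
  obtains P where "P \<in> carrier (SEM \<Omega>)" "cls \<phi> \<otimes>\<^bsub>SEM \<Omega>\<^esub> P = \<one>\<^bsub>SEM \<Omega>\<^esub>"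
    "P \<otimes>\<^bsub>SEM \<Omega>\<^esub> cls \<phi> = \<one>\<^bsub>SEM \<Omega>\<^esub>"
proof -
  have "\<forall>\<^sub>\<approx>z\<in>D. bnorm (\<phi> z) \<noteq> 0"
    using assms real_meromorphic_zero_or_nonzero[OF real_meromorphic_bnorm[OF \<phi>]]
    by (simp add: sem_zero_divisor_cls_iff)
  then have ev: "\<forall>\<^sub>\<approx>z\<in>D. \<phi> z * (bscalar (inverse (bnorm (\<phi> z))) * bconj (\<phi> z)) = 1 \<and>
      bscalar (inverse (bnorm (\<phi> z))) * bconj (\<phi> z) * \<phi> z = 1"
  proof eventually_elim
    case (elim z)
    have "w * (bscalar c * bconj w) = bscalar (c * bnorm w)" "bscalar c * bconj w * w = bscalar (c * bnorm w)"
      for w c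
      by (simp_all add: biquat_eq_iff bnorm_def power2_eq_square algebra_simps)
    moreover have "bscalar 1 = 1"
      by (simp add: biquat_eq_iff)
    ultimately show ?case
      using elim by simp
  qed
  have st: "stem (\<lambda>z. bscalar (inverse (bnorm (\<phi> z))) * bconj (\<phi> z))"
    by (intro stem_mult stem_bscalar real_meromorphic_inverse real_meromorphic_bnorm stem_bconj \<phi>)
  show ?thesis
    using \<phi> st ev
    by (intro that[of "cls (\<lambda>z. bscalar (inverse (bnorm (\<phi> z))) * bconj (\<phi> z))"])
      (simp_all add: mult_SEM one_SEM cls_eq_iff stem_mult stem_1 eventually_conj_iff)
qed

end

section \<open>Idempotents of zero divisors and solvability\<close>

text \<open>Every \<open>h\<close> satisfies \<open>h * h = 2 h\<^sub>0 h - h\<^sup>s\<close>. For \<open>h = w a\<close> with \<open>w\<^sup>s = 0\<close> the last term vanishes, and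
  cancelling \<open>a\<close> on the right of \<open>(2 h\<^sub>0)\<^sup>-\<^sup>1 h * h = h\<close> leaves the claim.\<close>

lemma biquat_null_normalize:
  assumes "bnorm w = 0" "norm a = 1" "b0 (w * bconst a) \<noteq> 0"
  shows "bscalar (inverse (2 * b0 (w * bconst a))) * (w * bconst a) * w = w"
proof -
  define h where "h = w * bconst a"
  define s where "s = inverse (2 * b0 h)"
  have sq: "h * h = bscalar (2 * b0 h) * h - bscalar (bnorm h)" for h
    by (simp add: biquat_eq_iff bnorm_def power2_eq_square algebra_simps)
  have "bnorm h = bnorm w * bnorm (bconst a)"
    by (simp add: h_def bnorm_def power2_eq_square algebra_simps)
  with assms(1) have "bnorm h = 0"
    by simp
  have "bscalar 0 = 0" "bscalar 1 = 1"
    by (simp_all add: biquat_eq_iff)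
  have "(qRe a)\<^sup>2 + (qI a)\<^sup>2 + (qJ a)\<^sup>2 + (qK a)\<^sup>2 = 1"
    using assms(2) by (simp add: norm_quat_def inner_quat_def power2_eq_square)
  then have "bnorm (bconst a) = 1"
    by (simp add: bnorm_def flip: of_real_power of_real_add)
  with mult_bconj[of "bconst a"] have a: "bconst a * bconj (bconst a) = 1"
    by (simp add: \<open>bscalar 1 = 1\<close>)
  have "bscalar s * h * h = bscalar s * bscalar (2 * b0 h) * h"
    using sq[of h] \<open>bnorm h = 0\<close> by (simp add: mult.assoc \<open>bscalar 0 = 0\<close>)
  also have "bscalar s * bscalar (2 * b0 h) = bscalar (s * (2 * b0 h))"
    by (simp add: biquat_eq_iff)
  also have "\<dots> = 1"
    using assms(3) by (simp add: s_def h_def[symmetric] \<open>bscalar 1 = 1\<close>)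
  finally have "bscalar s * h * (h * bconj (bconst a)) = h * bconj (bconst a)"
    by (simp flip: mult.assoc)
  moreover have "h * bconj (bconst a) = w"
    by (simp add: h_def mult.assoc a)
  ultimately show ?thesis
    by (simp add: s_def h_def)
qed

context circular_region
begin

text \<open>The element \<open>P\<close> is \<open>(2 (f a)\<^sub>0)\<^sup>-\<^sup>1 a\<close> if \<open>f\<close> is a zero divisor, and the inverse of \<open>f\<close> otherwise.\<close>

lemma left_factor:
  assumes \<phi>: "stem \<phi>" and nz: "cls \<phi> \<noteq> \<zero>\<^bsub>SEM \<Omega>\<^esub>"
    and zd: "sem_zero_divisor \<Omega> (cls \<phi>) \<Longrightarrow>
      norm a = 1 \<and> sem_re \<Omega> (cls \<phi> \<otimes>\<^bsub>SEM \<Omega>\<^esub> sem_const \<Omega> a) \<noteq> \<zero>\<^bsub>SEM \<Omega>\<^esub>"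
  defines "A \<equiv> if sem_zero_divisor \<Omega> (cls \<phi>) then sem_sigma \<Omega> (cls \<phi>) a else \<one>\<^bsub>SEM \<Omega>\<^esub>"
  obtains P where "P \<in> carrier (SEM \<Omega>)" "cls \<phi> \<otimes>\<^bsub>SEM \<Omega>\<^esub> P = A" "A \<otimes>\<^bsub>SEM \<Omega>\<^esub> cls \<phi> = cls \<phi>"
proof (cases "sem_zero_divisor \<Omega> (cls \<phi>)")
  case True
  then have a: "norm a = 1" and re: "sem_re \<Omega> (cls \<phi> \<otimes>\<^bsub>SEM \<Omega>\<^esub> sem_const \<Omega> a) \<noteq> \<zero>\<^bsub>SEM \<Omega>\<^esub>"
    using zd by blast+
  define s where "s z = bscalar (inverse (2 * b0 (\<phi> z * bconst a)))" for z
  have s: "stem s"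
    unfolding s_def using scaled_re_cls(2)[OF \<phi> re] by (rule stem_bscalar)
  have A: "A = cls (\<lambda>z. s z * (\<phi> z * bconst a))"
    using True sem_sigma_cls[OF \<phi> re] by (simp add: A_def s_def)
  have "\<forall>\<^sub>\<approx>z\<in>D. bnorm (\<phi> z) = 0"
    using True nz \<phi> by (simp add: sem_zero_divisor_cls_iff)
  then have ev: "\<forall>\<^sub>\<approx>z\<in>D. s z * (\<phi> z * bconst a) * \<phi> z = \<phi> z"
    using scaled_re_cls(1)[OF \<phi> re] unfolding s_def
    by eventually_elim (rule biquat_null_normalize[OF _ a])
  have "\<phi> z * (bconst a * s z) = s z * (\<phi> z * bconst a)" for z
    by (simp add: s_def biquat_eq_iff algebra_simps)
  then show ?thesis
    using \<phi> s ev
    by (intro that[of "cls (\<lambda>z. bconst a * s z)"])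
      (simp_all add: A mult_SEM stem_mult stem_const cls_eq_iff)
next
  case False
  obtain P where P: "P \<in> carrier (SEM \<Omega>)" "cls \<phi> \<otimes>\<^bsub>SEM \<Omega>\<^esub> P = \<one>\<^bsub>SEM \<Omega>\<^esub>"
    "P \<otimes>\<^bsub>SEM \<Omega>\<^esub> cls \<phi> = \<one>\<^bsub>SEM \<Omega>\<^esub>"
    using non_zero_divisor_inverse[OF \<phi> nz False] .
  moreover have "A = \<one>\<^bsub>SEM \<Omega>\<^esub>"
    using False by (simp add: A_def)
  ultimately show ?thesis
    using monoid.l_one[OF monoid_SEM cls_carrier[OF \<phi>]] by (intro that[of P]) simp_all
qed

text \<open>The mirror image of \<open>left_factor\<close>, with \<open>Q = (2 (f a)\<^sub>0)\<^sup>-\<^sup>1 a\<close> for a zero divisor. It rests on the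
  same identity, since \<open>f * ((2 (f a)\<^sub>0)\<^sup>-\<^sup>1 a f)\<close> and \<open>((2 (f a)\<^sub>0)\<^sup>-\<^sup>1 f a) * f\<close> are equal.\<close>

lemma right_factor:
  assumes \<phi>: "stem \<phi>" and nz: "cls \<phi> \<noteq> \<zero>\<^bsub>SEM \<Omega>\<^esub>"
    and zd: "sem_zero_divisor \<Omega> (cls \<phi>) \<Longrightarrow>
      norm a = 1 \<and> sem_re \<Omega> (cls \<phi> \<otimes>\<^bsub>SEM \<Omega>\<^esub> sem_const \<Omega> a) \<noteq> \<zero>\<^bsub>SEM \<Omega>\<^esub>"
  defines "B \<equiv> if sem_zero_divisor \<Omega> (cls \<phi>) then sem_rho \<Omega> (cls \<phi>) a else \<one>\<^bsub>SEM \<Omega>\<^esub>"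
  obtains Q where "Q \<in> carrier (SEM \<Omega>)" "Q \<otimes>\<^bsub>SEM \<Omega>\<^esub> cls \<phi> = B" "cls \<phi> \<otimes>\<^bsub>SEM \<Omega>\<^esub> B = cls \<phi>"
proof (cases "sem_zero_divisor \<Omega> (cls \<phi>)")
  case True
  then have a: "norm a = 1" and re: "sem_re \<Omega> (cls \<phi> \<otimes>\<^bsub>SEM \<Omega>\<^esub> sem_const \<Omega> a) \<noteq> \<zero>\<^bsub>SEM \<Omega>\<^esub>"
    using zd by blast+
  define s where "s z = bscalar (inverse (2 * b0 (\<phi> z * bconst a)))" for z
  have s: "stem s"
    unfolding s_def using scaled_re_cls(2)[OF \<phi> re] by (rule stem_bscalar)
  have B: "B = cls (\<lambda>z. s z * (bconst a * \<phi> z))"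
    using True sem_rho_cls[OF \<phi> re] by (simp add: B_def s_def)
  have "\<forall>\<^sub>\<approx>z\<in>D. bnorm (\<phi> z) = 0"
    using True nz \<phi> by (simp add: sem_zero_divisor_cls_iff)
  then have ev: "\<forall>\<^sub>\<approx>z\<in>D. s z * (\<phi> z * bconst a) * \<phi> z = \<phi> z"
    using scaled_re_cls(1)[OF \<phi> re] unfolding s_def
    by eventually_elim (rule biquat_null_normalize[OF _ a])
  have "w * (bscalar c * v) = bscalar c * (w * v)" for c v w
    by (simp add: biquat_eq_iff algebra_simps)
  then have "\<phi> z * (s z * (bconst a * \<phi> z)) = s z * (\<phi> z * bconst a) * \<phi> z" for z
    by (simp add: s_def mult.assoc)
  then show ?thesis
    using \<phi> s ev
    by (intro that[of "cls (\<lambda>z. s z * bconst a)"])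
      (simp_all add: B mult_SEM stem_mult stem_const cls_eq_iff mult.assoc)
next
  case False
  obtain P where P: "P \<in> carrier (SEM \<Omega>)" "cls \<phi> \<otimes>\<^bsub>SEM \<Omega>\<^esub> P = \<one>\<^bsub>SEM \<Omega>\<^esub>"
    "P \<otimes>\<^bsub>SEM \<Omega>\<^esub> cls \<phi> = \<one>\<^bsub>SEM \<Omega>\<^esub>"
    using non_zero_divisor_inverse[OF \<phi> nz False] .
  moreover have "B = \<one>\<^bsub>SEM \<Omega>\<^esub>"
    using False by (simp add: B_def)
  ultimately show ?thesis
    using monoid.r_one[OF monoid_SEM cls_carrier[OF \<phi>]] by (intro that[of P]) simp_all
qed

end

text \<open>The hypotheses say that \<open>p\<close> and \<open>q\<close> are generalized inverses, \<open>f p f = f\<close> and \<open>g q g = g\<close>; a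
  solution is \<open>p b q\<close>.\<close>

lemma (in monoid) two_sided_equation_solvable_iff:
  assumes carr: "f \<in> carrier G" "g \<in> carrier G" "p \<in> carrier G" "q \<in> carrier G" "b \<in> carrier G"
    and f: "f \<otimes> p = s" "s \<otimes> f = f" and g: "q \<otimes> g = r" "g \<otimes> r = g"
  shows "(\<exists>x\<in>carrier G. f \<otimes> x \<otimes> g = b) \<longleftrightarrow> b = s \<otimes> b \<and> b = b \<otimes> r"
proof
  have s: "s \<in> carrier G" and r: "r \<in> carrier G"
    using carr f(1) g(1) by auto
  {
    assume "\<exists>x\<in>carrier G. f \<otimes> x \<otimes> g = b"
    then obtain x where x: "x \<in> carrier G" "b = f \<otimes> x \<otimes> g"
      by blast
    have "s \<otimes> b = s \<otimes> f \<otimes> x \<otimes> g" "b \<otimes> r = f \<otimes> x \<otimes> (g \<otimes> r)"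
      using carr x s r by (simp_all add: m_assoc)
    then show "b = s \<otimes> b \<and> b = b \<otimes> r"
      using x(2) f(2) g(2) by simp
  next
    assume b: "b = s \<otimes> b \<and> b = b \<otimes> r"
    have "f \<otimes> (p \<otimes> b \<otimes> q) \<otimes> g = f \<otimes> p \<otimes> b \<otimes> (q \<otimes> g)"
      using carr by (simp add: m_assoc)
    also have "\<dots> = b"
      using b f(1) g(1) by simp
    finally show "\<exists>x\<in>carrier G. f \<otimes> x \<otimes> g = b"
      using carr by blast
  }
qed

theorem theorem3p3:
  fixes \<Omega> :: "quat set" and f g \<bb> :: sem and \<delta> \<eta> :: quat
  assumes "circular_domain \<Omega>"
    and "f \<in> carrier (SEM \<Omega>)" and "f \<noteq> \<zero>\<^bsub>SEM \<Omega>\<^esub>"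
    and "g \<in> carrier (SEM \<Omega>)" and "g \<noteq> \<zero>\<^bsub>SEM \<Omega>\<^esub>"
    and "sem_L \<Omega> f g \<notin> module_iso (SEM_R \<Omega>) (SEM \<Omega>) (SEM \<Omega>)"
    and "sem_zero_divisor \<Omega> f \<Longrightarrow>
      norm \<delta> = 1 \<and> sem_re \<Omega> (f \<otimes>\<^bsub>SEM \<Omega>\<^esub> sem_const \<Omega> \<delta>) \<noteq> \<zero>\<^bsub>SEM \<Omega>\<^esub>"
    and "sem_zero_divisor \<Omega> g \<Longrightarrow>
      norm \<eta> = 1 \<and> sem_re \<Omega> (g \<otimes>\<^bsub>SEM \<Omega>\<^esub> sem_const \<Omega> \<eta>) \<noteq> \<zero>\<^bsub>SEM \<Omega>\<^esub>"
    and "\<bb> \<in> carrier (SEM \<Omega>)"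
  shows "(\<exists>x\<in>carrier (SEM \<Omega>). sem_L \<Omega> f g x = \<bb>) \<longleftrightarrow>
    (sem_zero_divisor \<Omega> f \<longrightarrow> \<bb> = sem_sigma \<Omega> f \<delta> \<otimes>\<^bsub>SEM \<Omega>\<^esub> \<bb>) \<and>
    (sem_zero_divisor \<Omega> g \<longrightarrow> \<bb> = \<bb> \<otimes>\<^bsub>SEM \<Omega>\<^esub> sem_rho \<Omega> g \<eta>)"
proof -
  interpret circular_region \<Omega>
    by unfold_locales fact
  interpret S: monoid "SEM \<Omega>"
    by (rule monoid_SEM)
  obtain \<phi> where \<phi>: "stem \<phi>" "f = cls \<phi>"
    using SEM_cases[OF assms(2)] .
  obtain \<gamma> where \<gamma>: "stem \<gamma>" "g = cls \<gamma>"
    using SEM_cases[OF assms(4)] .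
  define A where "A = (if sem_zero_divisor \<Omega> f then sem_sigma \<Omega> f \<delta> else \<one>\<^bsub>SEM \<Omega>\<^esub>)"
  define B where "B = (if sem_zero_divisor \<Omega> g then sem_rho \<Omega> g \<eta> else \<one>\<^bsub>SEM \<Omega>\<^esub>)"
  obtain P where P: "P \<in> carrier (SEM \<Omega>)" "f \<otimes>\<^bsub>SEM \<Omega>\<^esub> P = A" "A \<otimes>\<^bsub>SEM \<Omega>\<^esub> f = f"
    using left_factor[of \<phi> \<delta>] \<phi> assms(3,7) unfolding A_def by blast
  obtain Q where Q: "Q \<in> carrier (SEM \<Omega>)" "Q \<otimes>\<^bsub>SEM \<Omega>\<^esub> g = B" "g \<otimes>\<^bsub>SEM \<Omega>\<^esub> B = g"
    using right_factor[of \<gamma> \<eta>] \<gamma> assms(5,8) unfolding B_def by blast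
  have "(\<exists>x\<in>carrier (SEM \<Omega>). f \<otimes>\<^bsub>SEM \<Omega>\<^esub> x \<otimes>\<^bsub>SEM \<Omega>\<^esub> g = \<bb>) \<longleftrightarrow>
      \<bb> = A \<otimes>\<^bsub>SEM \<Omega>\<^esub> \<bb> \<and> \<bb> = \<bb> \<otimes>\<^bsub>SEM \<Omega>\<^esub> B"
    using S.two_sided_equation_solvable_iff[OF assms(2,4) P(1) Q(1) assms(9) P(2,3) Q(2,3)] .
  moreover have "\<bb> = A \<otimes>\<^bsub>SEM \<Omega>\<^esub> \<bb> \<longleftrightarrow> (sem_zero_divisor \<Omega> f \<longrightarrow> \<bb> = sem_sigma \<Omega> f \<delta> \<otimes>\<^bsub>SEM \<Omega>\<^esub> \<bb>)"
    using S.l_one[OF assms(9)] by (simp add: A_def)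
  moreover have "\<bb> = \<bb> \<otimes>\<^bsub>SEM \<Omega>\<^esub> B \<longleftrightarrow> (sem_zero_divisor \<Omega> g \<longrightarrow> \<bb> = \<bb> \<otimes>\<^bsub>SEM \<Omega>\<^esub> sem_rho \<Omega> g \<eta>)"
    using S.r_one[OF assms(9)] by (simp add: B_def)
  ultimately show ?thesis
    by (simp only: sem_L_def)
qed

end
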